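(* Let $\mathcal{X}\subseteq\mathbb{R}^n$ be a model given as in (IS) or (ES), let $d=\dim\mathcal{X}$, and let $\mu=\hat\mu|_{\mathcal{X}}:\mathcal{X}\to\mathbb{R}^s$ be the restriction to $\mathcal X$ of a generic linear map $\hat\mu:\mathbb{R}^n\to\mathbb{R}^s$. Then: (E) For $y\in\mathbb{R}^s$, the fiber $\mu^{-1}(y)$ is nonempty if and only if the following system of polynomial equations has a real solution: in setting (IS), the system $f_1(x)=\cdots=f_k(x)=0,\ \hat\mu(x)-y=0$ in the variables $x=(x_1,\dots,x_n)$; in setting (ES), the system $\hat\mu(\phi(t))-y=0$ in the variables $t=(t_1,\dots,t_\ell)$. (R) If $s\ge d$, then for a generic point $x\in\mathcal{X}$ the fiber $\mu^{-1}(\mu(x))$ is finite. (I) If $s\ge d+1$, then for a generic point $x\in\mathcal{X}$ the fiber $\mu^{-1}(\mu(x))$ is equal to $\{x\}$. (C) If $s\ge d+1$, then for a generic point $x\in\mathcal{X}$ the fiber is $C^\infty$ continuous at $\mu(x)$: there is a Euclidean open neighborhood $U$ of $\mu(x)$ in $\mu(\mathcal{X})$ such that every $y'\in U$ has a unique preimage $\mu^{-1}(y')\in\mathcal{X}$, and $y'\mapsto\mu^{-1}(y')$ is a $C^\infty$ function of $y'\in U$.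
   Context: The model $\mathcal{X}$ is given in one of two ways. (IS): $\mathcal{X}=\{x\in\mathbb{R}^n: f_1(x)=\dots=f_k(x)=0\}$ for polynomials $f_1,\dots,f_k\in\mathbb{R}[x_1,\dots,x_n]$; in this case $\mathcal X$ is assumed irreducible, i.e. it is nonempty and not a union of two proper algebraic subvarieties. (ES): $\mathcal{X}=\{\phi(t):t\in\mathbb{R}^\ell\}$ for a polynomial map $\phi=(\phi_1,\dots,\phi_n):\mathbb{R}^\ell\to\mathbb{R}^n$ (its Zariski closure is then automatically irreducible). $\overline{\mathcal X}$ denotes the Zariski closure of $\mathcal X$ in $\mathbb{R}^n$, and $d=\dim\mathcal{X}=\dim\overline{\mathcal X}$ is the dimension of this algebraic variety; in (ES) it equals the maximal rank of the Jacobian matrix of $\phi$ over $\mathbb{R}^\ell$. $s\ge 1$ is an integer. Genericity: a property holds for a generic point of $\mathcal{X}$ if it holds for all points of $\mathcal{X}\cap U$ for some nonempty Zariski open subset $U$ of $\overline{\mathcal{X}}$. A property holds for a generic linear map $\hat\mu:\mathbb{R}^n\to\mathbb{R}^s$ if it holds for all $\hat\mu$ in some nonempty Zariski open subset of the vector space $\mathbb{R}^{s\times n}$ of linear maps. A function on a subset of $\mathbb{R}^s$ is $C^\infty$ if locally it is the restriction of a $C^\infty$ function defined on an open subset of $\mathbb{R}^s$. *)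

theory Defs
  imports "HOL-Analysis.Analysis" "HOL-Library.Extended_Nat"
begin

text \<open>
  Polynomials over the infinite field of real numbers are identified with the functions they induce
  (\<^const>\<open>real_polynomial_function\<close>, \<^const>\<open>polynomial_function\<close>). On \<^typ>\<open>real^'n^'s\<close> these are the
  polynomials in the matrix entries, so the Zariski topology below covers both the ambient space
  of a model and the space of linear maps.
\<close>

text \<open>Closed sets are the common zero sets of arbitrary families of polynomials; by Hilbert's basis
  theorem finite families would give the same sets.\<close>

definition zariski :: "'a::euclidean_space topology" where
  "zariski = topology (\<lambda>U. \<exists>F. (\<forall>f\<in>F. real_polynomial_function f) \<and> U = - {x. \<forall>f\<in>F. f x = 0})"

lemma openin_zariski:
  "openin zariski (U :: 'a::euclidean_space set) \<longleftrightarrow>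
     (\<exists>F. (\<forall>f\<in>F. real_polynomial_function f) \<and> U = - {x. \<forall>f\<in>F. f x = 0})"
proof -
  define Z where "Z F = - {x::'a. \<forall>f\<in>F. f x = (0::real)}" for F
  define P where "P U \<longleftrightarrow> (\<exists>F. (\<forall>f\<in>F. real_polynomial_function f) \<and> U = Z F)" for U
  have "istopology P"
    unfolding istopology_def
  proof (intro conjI allI impI)
    fix S T
    assume "P S" "P T"
    then obtain F G where F: "\<forall>f\<in>F. real_polynomial_function f" "S = Z F"
      and G: "\<forall>g\<in>G. real_polynomial_function g" "T = Z G"
      unfolding P_def by auto
    define H where "H = (\<lambda>(f, g) x. f x * g x) ` (F \<times> G)"
    have "\<forall>h\<in>H. real_polynomial_function h"
      using F(1) G(1) by (auto simp: H_def intro: real_polynomial_function.intros(4))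
    moreover have "S \<inter> T = Z H"
      by (auto simp: F(2) G(2) Z_def H_def)
    ultimately show "P (S \<inter> T)"
      unfolding P_def by (intro exI[of _ H] conjI)
  next
    fix K
    assume "\<forall>U\<in>K. P U"
    then obtain F where F: "\<forall>U\<in>K. (\<forall>f\<in>F U. real_polynomial_function f) \<and> U = Z (F U)"
      unfolding P_def bchoice_iff by (elim exE)
    have "\<Union>K = (\<Union>U\<in>K. Z (F U))"
      using F by simp
    also have "\<dots> = Z (\<Union>U\<in>K. F U)"
      by (auto simp: Z_def)
    finally have "\<Union>K = Z (\<Union>U\<in>K. F U)" .
    moreover have "\<forall>f\<in>(\<Union>U\<in>K. F U). real_polynomial_function f"
      using F by simp
    ultimately show "P (\<Union>K)"
      unfolding P_def by (intro exI[of _ "\<Union>U\<in>K. F U"] conjI)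
  qed
  then have "openin (topology P) U \<longleftrightarrow> P U"
    by simp
  moreover have "zariski = topology P"
    unfolding zariski_def P_def Z_def by (rule refl)
  ultimately show ?thesis
    unfolding P_def Z_def by simp
qed

lemma topspace_zariski [simp]: "topspace (zariski :: 'a::euclidean_space topology) = UNIV"
proof -
  have "openin zariski (UNIV :: 'a set)"
    unfolding openin_zariski
    by (intro exI[of _ "{\<lambda>x. 1}"]) (simp add: real_polynomial_function.intros(2))
  then show ?thesis
    using openin_subset by fastforce
qed

lemma closedin_zariski:
  "closedin zariski (V :: 'a::euclidean_space set) \<longleftrightarrow>
     (\<exists>F. (\<forall>f\<in>F. real_polynomial_function f) \<and> V = {x. \<forall>f\<in>F. f x = 0})"
proof -
  have "closedin zariski V \<longleftrightarrow> openin zariski (- V)"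
    by (simp add: closedin_def Compl_eq_Diff_UNIV)
  then show ?thesis
    by (simp only: openin_zariski compl_eq_compl_iff)
qed

definition irreducible_variety :: "'a::euclidean_space set \<Rightarrow> bool" where
  "irreducible_variety V \<longleftrightarrow>
     closedin zariski V \<and> V \<noteq> {} \<and>
     (\<nexists>A B. closedin zariski A \<and> closedin zariski B \<and> A \<subset> V \<and> B \<subset> V \<and> V = A \<union> B)"

text \<open>Krull dimension of the Zariski closure: the supremum of the lengths \<open>m\<close> of chains
  \<open>Z\<^sub>0 \<subset> \<dots> \<subset> Z\<^sub>m\<close> of irreducible subvarieties.\<close>

definition zariski_dim :: "'a::euclidean_space set \<Rightarrow> enat" where
  "zariski_dim X = Sup {enat m |m. \<exists>Z :: nat \<Rightarrow> 'a set.
     (\<forall>i\<le>m. irreducible_variety (Z i) \<and> Z i \<subseteq> zariski closure_of X) \<and>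
     (\<forall>i<m. Z i \<subset> Z (Suc i))}"

definition for_generic_point :: "'a::euclidean_space set \<Rightarrow> ('a \<Rightarrow> bool) \<Rightarrow> bool" where
  "for_generic_point X P \<longleftrightarrow>
     (\<exists>U. openin (subtopology zariski (zariski closure_of X)) U \<and> U \<noteq> {} \<and> (\<forall>x\<in>X \<inter> U. P x))"

text \<open>A linear map is represented by its matrix, which acts by \<open>(*v)\<close>.\<close>

definition for_generic_linear_map :: "(real^'n^'s \<Rightarrow> bool) \<Rightarrow> bool" where
  "for_generic_linear_map P \<longleftrightarrow> (\<exists>W. openin zariski W \<and> W \<noteq> {} \<and> (\<forall>A\<in>W. P A))"

text \<open>\<open>IS [f\<^sub>1, \<dots>, f\<^sub>k]\<close> is an implicitly given model, and \<open>ES \<phi>\<close> an explicitly parametrized one; in the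
  first case the type parameter \<open>'l\<close> plays no role.\<close>

datatype ('n, 'l) model = IS "(real^'n \<Rightarrow> real) list" | ES "real^'l \<Rightarrow> real^'n"

fun points :: "('n::finite, 'l::finite) model \<Rightarrow> (real^'n) set" where
  "points (IS fs) = {x. \<forall>f\<in>set fs. f x = 0}"
| "points (ES \<phi>) = {\<phi> t |t. t \<in> UNIV}"

fun valid_model :: "('n::finite, 'l::finite) model \<Rightarrow> bool" where
  "valid_model (IS fs) \<longleftrightarrow>
     (\<forall>f\<in>set fs. real_polynomial_function f) \<and> irreducible_variety (points (IS fs :: ('n, 'l) model))"
| "valid_model (ES \<phi>) \<longleftrightarrow> polynomial_function \<phi>"

fun system_solvable :: "('n::finite, 'l::finite) model \<Rightarrow> real^'n^'s \<Rightarrow> real^'s \<Rightarrow> bool" where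
  "system_solvable (IS fs) A y \<longleftrightarrow> (\<exists>x. (\<forall>f\<in>set fs. f x = 0) \<and> A *v x - y = 0)"
| "system_solvable (ES \<phi>) A y \<longleftrightarrow> (\<exists>t. A *v \<phi> t - y = 0)"

definition fiber :: "(real^'n) set \<Rightarrow> real^'n^'s \<Rightarrow> real^'s \<Rightarrow> (real^'n) set" where
  "fiber X A y = {x \<in> X. A *v x = y}"

text \<open>\<open>C\<^sup>k\<close> on an open set: differentiable, with all directional derivatives of class \<open>C\<^sup>k\<^sup>-\<^sup>1\<close>.
  The definition is only meaningful for open \<open>S\<close>, because derivatives are taken in the full space.\<close>

primrec Ck_on :: "nat \<Rightarrow> 'a::euclidean_space set \<Rightarrow> ('a \<Rightarrow> 'b::euclidean_space) \<Rightarrow> bool" where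
  "Ck_on 0 S f \<longleftrightarrow> continuous_on S f"
| "Ck_on (Suc k) S f \<longleftrightarrow>
     (\<forall>x\<in>S. f differentiable (at x)) \<and> (\<forall>v. Ck_on k S (\<lambda>x. frechet_derivative f (at x) v))"

definition smooth_on_subset :: "'a::euclidean_space set \<Rightarrow> ('a \<Rightarrow> 'b::euclidean_space) \<Rightarrow> bool" where
  "smooth_on_subset S f \<longleftrightarrow>
     (\<forall>x\<in>S. \<exists>V g. open V \<and> x \<in> V \<and> (\<forall>k. Ck_on k V g) \<and> (\<forall>z\<in>S \<inter> V. f z = g z))"

definition fiber_smooth_at :: "(real^'n) set \<Rightarrow> real^'n^'s \<Rightarrow> real^'s \<Rightarrow> bool" where
  "fiber_smooth_at X A y \<longleftrightarrow>
     (\<exists>U h. openin (top_of_set ((*v) A ` X)) U \<and> y \<in> U \<and>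
        (\<forall>y'\<in>U. fiber X A y' = {h y'}) \<and> smooth_on_subset U h)"

end

theory Submission
  imports Defs "HOL-Computational_Algebra.Primes"
begin

text \<open>
  Let \<open>X\<close> be a model. Everything rests on one notion. Fix a finite type of rows, let \<open>A\<close> be a
  matrix of indeterminates with these rows, and let \<open>J\<close> be a set of rows. A generic relation on
  \<open>J\<close> is a nonzero polynomial \<open>F(A, y)\<close>, in the entries of \<open>A\<close> and in variables \<open>y\<^sub>k\<close> with
  \<open>k \<in> J\<close>, that vanishes at \<open>y = (A x)\<^sub>J\<close> for all \<open>A\<close> and all \<open>x \<in> X\<close>. Thus it says that the
  generic linear forms with rows in \<open>J\<close> are algebraically dependent on \<open>X\<close>.

  A relation inverts the projection. Take a set of rows \<open>J\<close> without a relation and a row \<open>j\<close> such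
  that \<open>J \<union> {j}\<close> has one, and choose a relation \<open>F\<close> of least degree in \<open>y\<^sub>j\<close>. Differentiating
  \<open>F(A, A x) = 0\<close> with respect to the entry \<open>A\<^sub>j\<^sub>i\<close> yields
  \<open>\<partial>F/\<partial>A\<^sub>j\<^sub>i + x\<^sub>i \<cdot> \<partial>F/\<partial>y\<^sub>j = 0\<close>, and minimality keeps \<open>\<partial>F/\<partial>y\<^sub>j\<close> from vanishing identically. So
  every coordinate \<open>x\<^sub>i\<close> is one rational function \<open>p\<^sub>i/q\<close> of \<open>A\<close> and \<open>A x\<close>
  (\<open>birational_hypersurface\<close>). This is the primitive element theorem in the form used for Chow
  forms, and it is uniform in \<open>A\<close>. Where \<open>q \<noteq> 0\<close>, the point \<open>x\<close> is determined by \<open>A x\<close> and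
  depends smoothly on it, which settles the last two assertions (\<open>generic_injectivity\<close>).

  It remains to see that \<open>d + 1\<close> rows always have a relation, that is, that \<open>m\<close> rows without a
  relation force a chain of \<open>m + 1\<close> irreducible subvarieties of the closure
  (\<open>irreducible_chain\<close>, \<open>le_zariski_dim\<close>). The subvarieties must have enough real points. Replace
  the rows by a largest set \<open>J\<close> of rows without a relation; a further row \<open>j\<close> exists, because more
  forms than variables are dependent (\<open>generic_relation_UNIV\<close>). Near a real point with
  \<open>\<partial>F/\<partial>y\<^sub>j \<noteq> 0\<close> the intermediate value theorem solves \<open>F = 0\<close> for \<open>y\<^sub>j\<close>, and \<open>p/q\<close> carries these
  solutions into the variety: an equation of the variety becomes a polynomial vanishing on the
  graph, and pseudo-division by \<open>F\<close> shows that it vanishes on the hypersurface as well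
  (\<open>elimination\<close>). Hence the projection to the coordinates in \<open>J\<close> contains a ball
  (\<open>projection_contains_ball\<close>). A hyperplane section through its center is a proper closed subset
  whose projection still contains a ball in one dimension less, Hilbert's basis theorem
  (\<open>zariski_noetherian\<close>) provides an irreducible subset of it whose projection is still dense, and
  dense projection under one matrix excludes a generic relation
  (\<open>not_generic_relation_of_dominant\<close>). So the construction can be repeated.

  Finiteness for \<open>d\<close> rows: there is a relation after adding one row \<open>b\<close>. If there is none before, the
  coefficients of the relation with respect to the last variable do not all vanish, so \<open>b \<bullet> x\<close> takes
  finitely many values on a generic fiber; finitely many choices of \<open>b\<close> then bound all coordinates
  (\<open>generic_finiteness\<close>).
\<close>

section \<open>Polynomial functions\<close>

lemma real_polynomial_function_comp:
  assumes "polynomial_function f" "real_polynomial_function g"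
  shows "real_polynomial_function (\<lambda>x. g (f x))"
  using real_polynomial_function_compose[OF assms] by (simp add: o_def)

lemma polynomial_function_comp_linear:
  assumes "bounded_linear h" "polynomial_function f"
  shows "polynomial_function (\<lambda>x. h (f x))"
  using polynomial_function_compose[OF assms(2) polynomial_function_bounded_linear[OF assms(1)]]
  by (simp add: o_def)

lemma polynomial_function_Pair:
  assumes "polynomial_function f" "polynomial_function g"
  shows "polynomial_function (\<lambda>x. (f x, g x))"
proof -
  have "polynomial_function (\<lambda>x. (f x, 0) + (0, g x))"
    by (intro polynomial_function_add polynomial_function_comp_linear[where h = "\<lambda>y. (y, 0)"]
        polynomial_function_comp_linear[where h = "\<lambda>y. (0, y)"] assms
        bounded_linear_Pair bounded_linear_ident bounded_linear_zero)
  then show ?thesis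
    by simp
qed

lemma polynomial_function_vec:
  fixes f :: "'a::real_normed_vector \<Rightarrow> 'b::euclidean_space ^ 'n::finite"
  assumes "\<And>i. polynomial_function (\<lambda>x. f x $ i)"
  shows "polynomial_function f"
proof -
  have lin: "bounded_linear (axis i :: 'b \<Rightarrow> 'b ^ 'n)" for i
    unfolding linear_conv_bounded_linear[symmetric]
    by (rule linearI) (simp_all add: axis_def vec_eq_iff)
  have "f x = (\<Sum>i\<in>UNIV. axis i (f x $ i))" for x
    by (simp add: vec_eq_iff axis_def if_distrib cong: if_cong)
  then have "f = (\<lambda>x. \<Sum>i\<in>UNIV. axis i (f x $ i))"
    by blast
  moreover have "polynomial_function (\<lambda>x. \<Sum>i\<in>UNIV. axis i (f x $ i))"
    by (intro polynomial_function_sum polynomial_function_comp_linear[OF lin] assms) auto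
  ultimately show ?thesis
    by simp
qed

lemma polynomial_function_vec_nth:
  "polynomial_function f \<Longrightarrow> polynomial_function (\<lambda>x. f x $ i)"
  by (rule polynomial_function_comp_linear[OF bounded_linear_vec_nth])

lemma real_polynomial_function_vec_nth:
  fixes f :: "'a::real_normed_vector \<Rightarrow> real ^ 'n::finite"
  assumes "polynomial_function f"
  shows "real_polynomial_function (\<lambda>x. f x $ i)"
  using polynomial_function_vec_nth[OF assms] by (simp add: real_polynomial_function_eq)

lemma polynomial_function_fst: "polynomial_function f \<Longrightarrow> polynomial_function (\<lambda>x. fst (f x))"
  by (rule polynomial_function_comp_linear[OF bounded_linear_fst])

lemma polynomial_function_snd: "polynomial_function f \<Longrightarrow> polynomial_function (\<lambda>x. snd (f x))"
  by (rule polynomial_function_comp_linear[OF bounded_linear_snd])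

lemma polynomial_function_real:
  "real_polynomial_function f \<Longrightarrow> polynomial_function f"
  by (simp add: real_polynomial_function_eq)

lemma polynomial_function_matrix_vector:
  fixes f :: "'a::real_normed_vector \<Rightarrow> real ^ 'n ^ 's"
  assumes "polynomial_function f" "polynomial_function g"
  shows "polynomial_function (\<lambda>x. f x *v g x)"
proof (rule polynomial_function_vec)
  fix i
  have "real_polynomial_function (\<lambda>x. \<Sum>j\<in>UNIV. f x $ i $ j * g x $ j)"
    by (intro real_polynomial_function_sum real_polynomial_function.intros(4)
        real_polynomial_function_vec_nth polynomial_function_vec_nth assms) auto
  then show "polynomial_function (\<lambda>x. (f x *v g x) $ i)"
    by (simp add: matrix_vector_mult_def real_polynomial_function_eq)
qed

lemmas polynomial_intros =
  real_polynomial_function_vec_nth polynomial_function_vec_nth polynomial_function_fst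
  polynomial_function_snd polynomial_function_Pair polynomial_function_id
  polynomial_function_const real_polynomial_function.intros(2) real_polynomial_function.intros(3)
  real_polynomial_function.intros(4) real_polynomial_function_diff real_polynomial_function_power
  polynomial_function_add polynomial_function_diff polynomial_function_matrix_vector

text \<open>Restricted to the line through \<open>x0\<close> and \<open>y\<close>, the function is a univariate polynomial with
  infinitely many zeros.\<close>

lemma real_polynomial_function_eq_0_of_open:
  fixes f :: "'a::real_normed_vector \<Rightarrow> real"
  assumes f: "real_polynomial_function f" and S: "open S" "x0 \<in> S" and 0: "\<And>x. x \<in> S \<Longrightarrow> f x = 0"
  shows "f y = 0"
proof -
  define g where "g t = f (x0 + t *\<^sub>R (y - x0))" for t :: real
  have "real_polynomial_function g"
    unfolding g_def
    by (intro real_polynomial_function_comp[OF _ f] polynomial_function_add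
        polynomial_function_mult polynomial_function_const polynomial_function_id)
  then obtain a n where g: "g = (\<lambda>t. \<Sum>i\<le>n. a i * t ^ i)"
    unfolding real_polynomial_function_iff_sum by blast
  have "((\<lambda>t. x0 + t *\<^sub>R (y - x0)) \<longlongrightarrow> x0 + 0 *\<^sub>R (y - x0)) (at 0)"
    by (intro tendsto_intros)
  then have "eventually (\<lambda>t. x0 + t *\<^sub>R (y - x0) \<in> S) (at 0)"
    using S by (auto intro: topological_tendstoD)
  then obtain e where e: "e > 0" "\<And>t. t \<noteq> 0 \<Longrightarrow> \<bar>t\<bar> < e \<Longrightarrow> x0 + t *\<^sub>R (y - x0) \<in> S"
    by (auto simp: eventually_at)
  have "infinite {0<..<e}"
    using e(1) by (simp add: infinite_Ioo)
  moreover have "{0<..<e} \<subseteq> {t. (\<Sum>i\<le>n. a i * t ^ i) = 0}"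
  proof
    fix t assume "t \<in> {0<..<e}"
    then have "g t = 0"
      unfolding g_def by (intro 0 e(2)) auto
    then show "t \<in> {t. (\<Sum>i\<le>n. a i * t ^ i) = 0}"
      by (simp add: g)
  qed
  ultimately have "infinite {t. (\<Sum>i\<le>n. a i * t ^ i) = 0}"
    using finite_subset by blast
  then have "\<forall>i\<le>n. a i = 0"
    using polyfun_finite_roots[of a n] by blast
  then have "g 1 = 0"
    by (simp add: g)
  then show ?thesis
    by (simp add: g_def)
qed

lemma continuous_on_real_polynomial_function:
  "real_polynomial_function f \<Longrightarrow> continuous_on S f"
  by (rule continuous_on_polymonial_function) (simp add: real_polynomial_function_eq[symmetric])

lemma open_neq_0_real_polynomial_function:
  fixes f :: "'a::euclidean_space \<Rightarrow> real"
  assumes "real_polynomial_function f"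
  shows "open {x. f x \<noteq> 0}"
  by (intro open_Collect_neq continuous_on_real_polynomial_function[OF assms] continuous_on_const)

lemma real_polynomial_function_mult_eq_0:
  fixes f g :: "'a::euclidean_space \<Rightarrow> real"
  assumes f: "real_polynomial_function f" and g: "real_polynomial_function g"
    and "\<And>x. f x * g x = 0"
  shows "(\<forall>x. f x = 0) \<or> (\<forall>x. g x = 0)"
proof (rule ccontr)
  assume "\<not> ?thesis"
  then obtain x y where "f x \<noteq> 0" "g y \<noteq> 0"
    by blast
  moreover have "g y = 0"
  proof (rule real_polynomial_function_eq_0_of_open[OF g])
    show "open {x. f x \<noteq> 0}" "x \<in> {x. f x \<noteq> 0}"
      using open_neq_0_real_polynomial_function[OF f] \<open>f x \<noteq> 0\<close> by auto
    show "g z = 0" if "z \<in> {x. f x \<noteq> 0}" for z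
      using that assms(3)[of z] by simp
  qed
  ultimately show False
    by simp
qed

text \<open>Partial derivatives of polynomials are again polynomials; this is what makes the derivative of a
  relation with respect to the matrix entries usable as the numerator of a rational function.\<close>

lemma real_polynomial_function_has_derivative:
  fixes f :: "'a::euclidean_space \<Rightarrow> real"
  assumes "real_polynomial_function f"
  obtains f' where "\<And>v. real_polynomial_function (\<lambda>x. f' x v)"
    and "\<And>x. (f has_derivative f' x) (at x)"
proof -
  have "\<exists>f'. (\<forall>v. real_polynomial_function (\<lambda>x. f' x v)) \<and> (\<forall>x. (f has_derivative f' x) (at x))"
    using assms
  proof induction
    case (linear f)
    then show ?case
      by (intro exI[of _ "\<lambda>_. f"])
        (simp add: bounded_linear_imp_has_derivative real_polynomial_function.intros(1,2))
  next
    case (const c)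
    then show ?case
      by (intro exI[of _ "\<lambda>_ _. 0"]) (simp add: real_polynomial_function.intros(2))
  next
    case (add f g)
    then obtain f' g' where *: "\<forall>v. real_polynomial_function (\<lambda>x. f' x v)"
      "\<forall>x. (f has_derivative f' x) (at x)" "\<forall>v. real_polynomial_function (\<lambda>x. g' x v)"
      "\<forall>x. (g has_derivative g' x) (at x)"
      by blast
    show ?case
      by (intro exI[of _ "\<lambda>x v. f' x v + g' x v"] conjI allI real_polynomial_function.intros(3)
          has_derivative_add) (simp_all add: *)
  next
    case (mult f g)
    then obtain f' g' where *: "\<forall>v. real_polynomial_function (\<lambda>x. f' x v)"
      "\<forall>x. (f has_derivative f' x) (at x)" "\<forall>v. real_polynomial_function (\<lambda>x. g' x v)"
      "\<forall>x. (g has_derivative g' x) (at x)"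
      by blast
    show ?case
      by (intro exI[of _ "\<lambda>x v. f x * g' x v + f' x v * g x"] conjI allI
          real_polynomial_function.intros(3) real_polynomial_function.intros(4) has_derivative_mult)
        (simp_all add: * mult.hyps)
  qed
  then show ?thesis
    using that by blast
qed

text \<open>Polynomials on \<open>E \<times> \<real>\<close> are polynomials in the real variable with coefficients in the
  polynomials on \<open>E\<close>. The degree in that variable drives elimination and specialization.\<close>

lemma real_polynomial_function_last_variable:
  fixes G :: "'a::euclidean_space \<times> real \<Rightarrow> real"
  assumes "real_polynomial_function G"
  obtains N c where "\<And>k. real_polynomial_function (c k)"
    and "\<And>u z. G (u, z) = (\<Sum>k\<le>N. c k u * z ^ k)"
proof -
  have "\<exists>N c. (\<forall>k. real_polynomial_function (c k)) \<and> (\<forall>k>N. \<forall>u. c k u = 0) \<and>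
      (\<forall>u z. G (u, z) = (\<Sum>k\<le>N. c k u * z ^ k))"
    using assms
  proof induction
    case (linear f)
    then have bl: "bounded_linear f" .
    then interpret bounded_linear f .
    have f: "f (u, z) = f (u, 0) + f (0, 1) * z" for u z
      using add[of "(u, 0)" "(0, z)"] scaleR[of z "(0, 1)"] by simp
    have 0: "real_polynomial_function (\<lambda>u. f (u, 0))"
      by (intro real_polynomial_function.intros(1) bounded_linear_compose[OF bl]
          bounded_linear_Pair bounded_linear_ident bounded_linear_zero)
    define c where "c k = (if k = 0 then (\<lambda>u. f (u, 0)) else if k = 1 then (\<lambda>u. f (0, 1)) else (\<lambda>u. 0))"
      for k :: nat
    have "f (u, z) = (\<Sum>k\<le>1. c k u * z ^ k)" for u z
      by (subst f) (simp add: c_def)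
    moreover have "real_polynomial_function (c k)" for k
      by (auto simp: c_def intro: 0)
    moreover have "c k u = 0" if "k > 1" for k u
      using that by (simp add: c_def)
    ultimately show ?case
      by blast
  next
    case (const a)
    show ?case
      by (intro exI[of _ 0] exI[of _ "\<lambda>k u. if k = 0 then a else 0"])
        (simp add: real_polynomial_function.intros(2))
  next
    case (add f g)
    obtain M c where f: "\<forall>k. real_polynomial_function (c k)" "\<forall>k>M. \<forall>u. c k u = 0"
      "\<forall>u z. f (u, z) = (\<Sum>k\<le>M. c k u * z ^ k)"
      using add.IH(1) by blast
    obtain N d where g: "\<forall>k. real_polynomial_function (d k)" "\<forall>k>N. \<forall>u. d k u = 0"
      "\<forall>u z. g (u, z) = (\<Sum>k\<le>N. d k u * z ^ k)"
      using add.IH(2) by blast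
    note * = f g
    have f': "f (u, z) = (\<Sum>k\<le>M+N. c k u * z ^ k)" for u z
      unfolding f(3)[rule_format] by (rule sum.mono_neutral_left) (use f(2) in auto)
    have g': "g (u, z) = (\<Sum>k\<le>M+N. d k u * z ^ k)" for u z
      unfolding g(3)[rule_format] by (rule sum.mono_neutral_left) (use g(2) in auto)
    have "f (u, z) + g (u, z) = (\<Sum>k\<le>M+N. (c k u + d k u) * z ^ k)" for u z
      unfolding f' g' by (simp add: algebra_simps sum.distrib)
    then show ?case
      by (intro exI[of _ "M+N"] exI[of _ "\<lambda>k u. c k u + d k u"])
        (simp add: f(1,2) g(1,2) real_polynomial_function.intros(3))
  next
    case (mult f g)
    obtain M c where f: "\<forall>k. real_polynomial_function (c k)" "\<forall>k>M. \<forall>u. c k u = 0"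
      "\<forall>u z. f (u, z) = (\<Sum>k\<le>M. c k u * z ^ k)"
      using mult.IH(1) by blast
    obtain N d where g: "\<forall>k. real_polynomial_function (d k)" "\<forall>k>N. \<forall>u. d k u = 0"
      "\<forall>u z. g (u, z) = (\<Sum>k\<le>N. d k u * z ^ k)"
      using mult.IH(2) by blast
    note * = f g
    have "(\<Sum>k\<le>r. c k u * d (r - k) u) = 0" if "r > M + N" for r u
    proof (intro sum.neutral ballI)
      fix k assume "k \<in> {..r}"
      then have "k > M \<or> r - k > N"
        using that by auto
      then show "c k u * d (r - k) u = 0"
        using * by auto
    qed
    moreover have "f (u, z) * g (u, z) = (\<Sum>r\<le>M + N. (\<Sum>k\<le>r. c k u * d (r - k) u) * z ^ r)" for u z
      unfolding *(3)[rule_format] *(6)[rule_format]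
      by (rule polynomial_product) (use * in auto)
    moreover have "real_polynomial_function (\<lambda>u. \<Sum>k\<le>r. c k u * d (r - k) u)" for r
    proof (rule real_polynomial_function_sum)
      show "real_polynomial_function (\<lambda>u. c k u * d (r - k) u)" for k
        using f(1) g(1) by (simp add: real_polynomial_function.intros(4))
    qed simp
    ultimately have "(\<forall>r. real_polynomial_function (\<lambda>u. \<Sum>k\<le>r. c k u * d (r - k) u)) \<and>
        (\<forall>r>M + N. \<forall>u. (\<Sum>k\<le>r. c k u * d (r - k) u) = 0) \<and>
        (\<forall>u z. f (u, z) * g (u, z) = (\<Sum>r\<le>M + N. (\<Sum>k\<le>r. c k u * d (r - k) u) * z ^ r))"
      by simp
    then show ?case
      by (intro exI)
  qed
  then show ?thesis
    using that by blast
qed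

text \<open>Clearing denominators in \<open>f (p / q)\<close>. It turns an equation of a variety, evaluated at a
  rationally parametrized point, into a polynomial equation for the parameters.\<close>

lemma real_polynomial_function_homogenize:
  fixes f :: "'a::euclidean_space \<Rightarrow> real"
  assumes "real_polynomial_function f"
  obtains k h where "real_polynomial_function (h :: real \<times> 'a \<Rightarrow> real)"
    and "\<And>q p. q \<noteq> 0 \<Longrightarrow> h (q, p) = q ^ k * f (inverse q *\<^sub>R p)"
proof -
  have "\<exists>k h. real_polynomial_function (h :: real \<times> 'a \<Rightarrow> real) \<and>
     (\<forall>q p. q \<noteq> 0 \<longrightarrow> h (q, p) = q ^ k * f (inverse q *\<^sub>R p))"
    using assms
  proof induction
    case (linear f)
    then have bl: "bounded_linear f" .
    then interpret bounded_linear f .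
    have "real_polynomial_function (\<lambda>x :: real \<times> 'a. f (snd x))"
      by (intro real_polynomial_function.intros(1) bounded_linear_compose[OF bl] bounded_linear_snd)
    then show ?case
      by (intro exI[of _ 1] exI[of _ "\<lambda>x. f (snd x)"]) (auto simp: scaleR)
  next
    case (const c)
    show ?case
      by (intro exI[of _ 0] exI[of _ "\<lambda>_. c"]) auto
  next
    case (add f g)
    then obtain k h l i where *: "real_polynomial_function (h :: real \<times> 'a \<Rightarrow> real)"
     "\<forall>q p. q \<noteq> 0 \<longrightarrow> h (q, p) = q ^ k * f (inverse q *\<^sub>R p)"
     "real_polynomial_function (i :: real \<times> 'a \<Rightarrow> real)"
     "\<forall>q p. q \<noteq> 0 \<longrightarrow> i (q, p) = q ^ l * g (inverse q *\<^sub>R p)"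
      by blast
    have "real_polynomial_function (\<lambda>x :: real \<times> 'a. fst x)"
      by (intro real_polynomial_function.intros(1) bounded_linear_fst)
    then have "real_polynomial_function (\<lambda>x. fst x ^ l * h x + fst x ^ k * i x)"
      by (intro real_polynomial_function.intros(3,4) real_polynomial_function_power *(1,3))
    moreover have "\<forall>q p. q \<noteq> 0 \<longrightarrow> q ^ l * h (q, p) + q ^ k * i (q, p) =
        q ^ (k + l) * (f (inverse q *\<^sub>R p) + g (inverse q *\<^sub>R p))"
      using *(2,4) by (simp add: power_add algebra_simps)
    ultimately show ?case
      by (intro exI[of _ "k + l"] exI[of _ "\<lambda>x. fst x ^ l * h x + fst x ^ k * i x"]) simp
  next
    case (mult f g)
    then obtain k h l i where *: "real_polynomial_function (h :: real \<times> 'a \<Rightarrow> real)"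
     "\<forall>q p. q \<noteq> 0 \<longrightarrow> h (q, p) = q ^ k * f (inverse q *\<^sub>R p)"
     "real_polynomial_function (i :: real \<times> 'a \<Rightarrow> real)"
     "\<forall>q p. q \<noteq> 0 \<longrightarrow> i (q, p) = q ^ l * g (inverse q *\<^sub>R p)"
      by blast
    then have "real_polynomial_function (\<lambda>x. h x * i x)"
      by (simp add: real_polynomial_function.intros(4))
    moreover have "\<forall>q p. q \<noteq> 0 \<longrightarrow>
        h (q, p) * i (q, p) = q ^ (k + l) * (f (inverse q *\<^sub>R p) * g (inverse q *\<^sub>R p))"
      using * by (simp add: power_add)
    ultimately show ?case
      by blast
  qed
  then show ?thesis
    using that by blast
qed

section \<open>The Zariski topology is Noetherian\<close>

text \<open>Every sequence has a monotone subsequence, and a decreasing sequence of natural numbers is eventually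
  constant.\<close>

lemma incseq_subseq_nat:
  fixes s :: "nat \<Rightarrow> nat"
  obtains r where "strict_mono r" "incseq (\<lambda>n. s (r n))"
proof -
  obtain r where r: "strict_mono r" "monoseq (\<lambda>n. s (r n))"
    using seq_monosub by blast
  show ?thesis
  proof (cases "incseq (\<lambda>n. s (r n))")
    case True
    then show ?thesis
      using r that by blast
  next
    case False
    then have dec: "decseq (\<lambda>n. s (r n))"
      using r(2) by (simp add: monoseq_iff)
    define m where "m = (LEAST v. v \<in> range (\<lambda>n. s (r n)))"
    have "m \<in> range (\<lambda>n. s (r n))"
      unfolding m_def by (rule LeastI[of _ "s (r 0)"]) simp
    then obtain k where k: "m = s (r k)"
      by blast
    have "s (r (n + k)) = m" for n
    proof (rule antisym)
      show "s (r (n + k)) \<le> m"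
        unfolding k using dec by (simp add: decseq_def)
      show "m \<le> s (r (n + k))"
        unfolding m_def by (rule Least_le) simp
    qed
    then have "incseq (\<lambda>n. s ((\<lambda>n. r (n + k)) n))"
      by (simp add: incseq_def)
    moreover have "strict_mono (\<lambda>n. r (n + k))"
      using r(1) by (simp add: strict_mono_def)
    ultimately show ?thesis
      using that by blast
  qed
qed

text \<open>Dickson's lemma for exponent vectors, obtained by passing to subsequences one coordinate at a
  time.\<close>

lemma dickson:
  fixes s :: "nat \<Rightarrow> 'i \<Rightarrow> nat"
  assumes "finite I"
  obtains r where "strict_mono r" "\<And>i. i \<in> I \<Longrightarrow> incseq (\<lambda>n. s (r n) i)"
proof -
  have "\<exists>r. strict_mono r \<and> (\<forall>i\<in>I. incseq (\<lambda>n. s (r n) i))"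
    using assms
  proof induction
    case empty
    then show ?case
      by (intro exI[of _ id]) (auto simp: strict_mono_def)
  next
    case (insert j I)
    then obtain r where r: "strict_mono r" "\<forall>i\<in>I. incseq (\<lambda>n. s (r n) i)"
      by blast
    obtain r' where r': "strict_mono r'" "incseq (\<lambda>n. s (r (r' n)) j)"
      using incseq_subseq_nat[of "\<lambda>n. s (r n) j"] by blast
    have "incseq (\<lambda>n. s (r (r' n)) i)" if "i \<in> I" for i
      using r(2) that strict_mono_mono[OF r'(1)] by (force simp: incseq_def monotone_on_def)
    then show ?case
      using r r' by (intro exI[of _ "\<lambda>n. r (r' n)"]) (auto simp: strict_mono_def)
  qed
  then show ?thesis
    using that by blast
qed

lemma inj_primes: "\<exists>p :: 'n::finite \<Rightarrow> nat. inj p \<and> (\<forall>i. prime (p i))"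
proof -
  have "infinite {p :: nat. prime p}"
    by (rule primes_infinite)
  then obtain S where S: "S \<subseteq> {p :: nat. prime p}" "finite S" "card S = CARD('n)"
    using infinite_arbitrarily_large by blast
  then obtain p where "bij_betw p (UNIV :: 'n set) S"
    using finite_same_card_bij[of "UNIV :: 'n set" S] by auto
  then show ?thesis
    using S(1) unfolding bij_betw_def by (intro exI[of _ p]) auto
qed

text \<open>A monomial order by numbers: the exponent vector \<open>\<alpha>\<close> is encoded as \<open>\<Prod>p\<^sub>i ^ \<alpha>\<^sub>i\<close> for distinct
  primes \<open>p\<^sub>i\<close>. Unique factorization makes the induced order total, multiplicativity makes it
  compatible with products of monomials, and it is well-founded because its values are natural
  numbers.\<close>

definition monomial_weight :: "('n::finite \<Rightarrow> nat) \<Rightarrow> nat" where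
  "monomial_weight \<alpha> =
     (\<Prod>i\<in>UNIV. (SOME p :: 'n \<Rightarrow> nat. inj p \<and> (\<forall>i. prime (p i))) i ^ \<alpha> i)"

lemma monomial_weight_add:
  "monomial_weight (\<lambda>i. \<alpha> i + \<beta> i) = monomial_weight \<alpha> * monomial_weight \<beta>"
  by (simp add: monomial_weight_def power_add prod.distrib)

lemma
  fixes \<alpha> :: "'n::finite \<Rightarrow> nat"
  shows monomial_weight_pos: "monomial_weight \<alpha> > 0"
    and inj_monomial_weight: "inj (monomial_weight :: ('n \<Rightarrow> nat) \<Rightarrow> nat)"
proof -
  define p where "p = (SOME p :: 'n \<Rightarrow> nat. inj p \<and> (\<forall>i. prime (p i)))"
  have "inj p \<and> (\<forall>i. prime (p i))"
    unfolding p_def by (rule someI_ex[OF inj_primes])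
  then have p: "inj p" "\<And>i. prime (p i)"
    by auto
  have w: "monomial_weight \<alpha> = (\<Prod>i\<in>UNIV. p i ^ \<alpha> i)" for \<alpha> :: "'n \<Rightarrow> nat"
    by (simp add: monomial_weight_def p_def)
  show "monomial_weight \<alpha> > 0"
    unfolding w using p(2) by (intro prod_pos) (simp add: prime_gt_0_nat)
  have "multiplicity (p i) (monomial_weight \<alpha>) = \<alpha> i" for i and \<alpha> :: "'n \<Rightarrow> nat"
  proof -
    have "monomial_weight \<alpha> = (\<Prod>q\<in>range p. q ^ \<alpha> (inv p q))"
      unfolding w by (subst prod.reindex[OF p(1)]) (simp add: p(1))
    also have "multiplicity (p i) \<dots> = (if p i \<in> range p then \<alpha> (inv p (p i)) else 0)"
      by (rule multiplicity_prod_prime_powers) (use p(2) in auto)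
    finally show ?thesis
      by (simp add: p(1))
  qed
  then show "inj (monomial_weight :: ('n \<Rightarrow> nat) \<Rightarrow> nat)"
    by (intro injI ext) metis
qed

definition monom_fun :: "('n::finite \<Rightarrow> nat) \<Rightarrow> real ^ 'n \<Rightarrow> real" where
  "monom_fun \<alpha> x = (\<Prod>i\<in>UNIV. (x $ i) ^ \<alpha> i)"

lemma monom_fun_add: "monom_fun (\<lambda>i. \<alpha> i + \<beta> i) x = monom_fun \<alpha> x * monom_fun \<beta> x"
  by (simp add: monom_fun_def power_add prod.distrib)

lemma real_polynomial_function_monom_fun: "real_polynomial_function (monom_fun \<alpha>)"
  unfolding monom_fun_def
  by (intro real_polynomial_function_prod polynomial_intros) auto

definition weight_le :: "nat \<Rightarrow> (real ^ 'n::finite \<Rightarrow> real) \<Rightarrow> bool" where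
  "weight_le K f \<longleftrightarrow> (\<exists>A c. finite A \<and> (\<forall>\<alpha>\<in>A. monomial_weight \<alpha> \<le> K) \<and>
     (\<forall>x. f x = (\<Sum>\<alpha>\<in>A. c \<alpha> * monom_fun \<alpha> x)))"

lemma weight_le_mono: "weight_le K f \<Longrightarrow> K \<le> L \<Longrightarrow> weight_le L f"
  unfolding weight_le_def by (meson order_trans)

lemma weight_le_monom:
  assumes "monomial_weight \<alpha> \<le> K"
  shows "weight_le K (\<lambda>x. c * monom_fun \<alpha> x)"
  unfolding weight_le_def using assms by (intro exI[of _ "{\<alpha>}"] exI[of _ "\<lambda>_. c"]) auto

lemma weight_le_add:
  assumes "weight_le K f" "weight_le K g"
  shows "weight_le K (\<lambda>x. f x + g x)"
proof -
  obtain A c where A: "finite A" "\<forall>\<alpha>\<in>A. monomial_weight \<alpha> \<le> K"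
    and f: "\<forall>x. f x = (\<Sum>\<alpha>\<in>A. c \<alpha> * monom_fun \<alpha> x)"
    using assms(1) unfolding weight_le_def by blast
  obtain B d where B: "finite B" "\<forall>\<alpha>\<in>B. monomial_weight \<alpha> \<le> K"
    and g: "\<forall>x. g x = (\<Sum>\<alpha>\<in>B. d \<alpha> * monom_fun \<alpha> x)"
    using assms(2) unfolding weight_le_def by blast
  define c' where "c' \<alpha> = (if \<alpha> \<in> A then c \<alpha> else 0)" for \<alpha>
  define d' where "d' \<alpha> = (if \<alpha> \<in> B then d \<alpha> else 0)" for \<alpha>
  have "f x = (\<Sum>\<alpha>\<in>A \<union> B. c' \<alpha> * monom_fun \<alpha> x)" for x
    unfolding f[rule_format] by (rule sum.mono_neutral_cong_left) (use A B in \<open>auto simp: c'_def\<close>)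
  moreover have "g x = (\<Sum>\<alpha>\<in>A \<union> B. d' \<alpha> * monom_fun \<alpha> x)" for x
    unfolding g[rule_format] by (rule sum.mono_neutral_cong_left) (use A B in \<open>auto simp: d'_def\<close>)
  ultimately have "f x + g x = (\<Sum>\<alpha>\<in>A \<union> B. (c' \<alpha> + d' \<alpha>) * monom_fun \<alpha> x)" for x
    by (simp add: sum.distrib algebra_simps)
  then show ?thesis
    unfolding weight_le_def using A B by (intro exI[of _ "A \<union> B"] exI[of _ "\<lambda>\<alpha>. c' \<alpha> + d' \<alpha>"]) auto
qed

lemma weight_le_0: "weight_le K (\<lambda>x. 0)"
  unfolding weight_le_def by (intro exI[of _ "{}"]) auto

lemma weight_le_sum:
  assumes "finite I" "\<And>i. i \<in> I \<Longrightarrow> weight_le K (f i)"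
  shows "weight_le K (\<lambda>x. \<Sum>i\<in>I. f i x)"
  using assms by (induction I rule: finite_induct) (auto intro: weight_le_add weight_le_0)

lemma weight_le_monom_mult:
  assumes "weight_le K f"
  shows "weight_le (monomial_weight \<beta> * K) (\<lambda>x. c * monom_fun \<beta> x * f x)"
proof -
  obtain A d where A: "finite A" "\<forall>\<alpha>\<in>A. monomial_weight \<alpha> \<le> K"
    and f: "\<forall>x. f x = (\<Sum>\<alpha>\<in>A. d \<alpha> * monom_fun \<alpha> x)"
    using assms(1) unfolding weight_le_def by blast
  have "c * monom_fun \<beta> x * f x = (\<Sum>\<alpha>\<in>A. c * d \<alpha> * monom_fun (\<lambda>i. \<beta> i + \<alpha> i) x)" for x
    unfolding f[rule_format] by (simp add: sum_distrib_left monom_fun_add mult_ac)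
  moreover have "weight_le (monomial_weight \<beta> * K)
      (\<lambda>x. \<Sum>\<alpha>\<in>A. c * d \<alpha> * monom_fun (\<lambda>i. \<beta> i + \<alpha> i) x)"
    using A by (intro weight_le_sum weight_le_monom) (auto simp: monomial_weight_add)
  ultimately show ?thesis
    by simp
qed

lemma weight_le_mult:
  assumes "weight_le K f" "weight_le L g"
  shows "weight_le (K * L) (\<lambda>x. f x * g x)"
proof -
  obtain A d where A: "finite A" "\<forall>\<alpha>\<in>A. monomial_weight \<alpha> \<le> K"
    and f: "\<forall>x. f x = (\<Sum>\<alpha>\<in>A. d \<alpha> * monom_fun \<alpha> x)"
    using assms(1) unfolding weight_le_def by blast
  have "weight_le (K * L) (\<lambda>x. \<Sum>\<alpha>\<in>A. d \<alpha> * monom_fun \<alpha> x * g x)"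
    using A by (intro weight_le_sum weight_le_mono[OF weight_le_monom_mult[OF assms(2)]]) auto
  then show ?thesis
    by (simp add: f sum_distrib_right)
qed

lemma real_polynomial_function_weight_le:
  fixes f :: "real ^ 'n::finite \<Rightarrow> real"
  assumes "real_polynomial_function f"
  shows "\<exists>K. weight_le K f"
  using assms
proof induction
  case (linear f)
  then interpret bounded_linear f .
  have mon: "monom_fun (\<lambda>k. if k = i then 1 else 0) x = x $ i" for i and x :: "real ^ 'n"
    by (simp add: monom_fun_def if_distrib prod.delta cong: if_cong)
  have f: "f x = (\<Sum>i\<in>UNIV. f (axis i 1) * monom_fun (\<lambda>k. if k = i then 1 else 0) x)" for x
  proof -
    have "f x = f (\<Sum>i\<in>UNIV. x $ i *\<^sub>R axis i 1)"
      using basis_expansion[of x] by (simp add: scalar_mult_eq_scaleR)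
    also have "\<dots> = (\<Sum>i\<in>UNIV. f (axis i 1) * x $ i)"
      by (simp add: sum scaleR mult.commute)
    finally show ?thesis
      by (simp add: mon)
  qed
  define K where "K = (\<Sum>i\<in>(UNIV :: 'n set). monomial_weight (\<lambda>k. if k = i then 1 else 0 :: nat))"
  have "monomial_weight (\<lambda>k. if k = i then 1 else 0 :: nat) \<le> K" for i :: 'n
    unfolding K_def by (rule member_le_sum) auto
  then have "weight_le K (\<lambda>x. \<Sum>i\<in>UNIV. f (axis i 1) * monom_fun (\<lambda>k. if k = i then 1 else 0) x)"
    by (intro weight_le_sum weight_le_monom) auto
  moreover have "(\<lambda>x. \<Sum>i\<in>UNIV. f (axis i 1) * monom_fun (\<lambda>k. if k = i then 1 else 0) x) = f"
    by (rule ext) (rule f[symmetric])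
  ultimately have "weight_le K f"
    by (simp only:)
  then show ?case
    by blast
next
  case (const c)
  have "weight_le (monomial_weight (\<lambda>_ :: 'n. 0 :: nat)) (\<lambda>x :: real ^ 'n. c * monom_fun (\<lambda>_. 0) x)"
    by (rule weight_le_monom) simp
  then show ?case
    by (auto simp: monom_fun_def)
next
  case (add f g)
  then obtain K L where "weight_le K f" "weight_le L g"
    by blast
  then have "weight_le (max K L) f" "weight_le (max K L) g"
    by (auto intro: weight_le_mono)
  then show ?case
    using weight_le_add by blast
next
  case (mult f g)
  then show ?case
    using weight_le_mult by blast
qed

text \<open>If \<open>K\<close> is the least possible weight bound, then the weight \<open>K\<close> must occur, and by injectivity of
  the weight it occurs for a single monomial.\<close>

lemma weight_le_leading_monomial:
  assumes f: "weight_le K f" and min: "\<And>L. L < K \<Longrightarrow> \<not> weight_le L f" and ne: "f x0 \<noteq> 0"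
  obtains \<alpha> c r where "monomial_weight \<alpha> = K" "c \<noteq> 0" "weight_le (K - 1) r"
    "\<And>x. f x = c * monom_fun \<alpha> x + r x"
proof -
  obtain A d where A: "finite A" "\<forall>\<alpha>\<in>A. monomial_weight \<alpha> \<le> K"
    and f: "\<forall>x. f x = (\<Sum>\<alpha>\<in>A. d \<alpha> * monom_fun \<alpha> x)"
    using f unfolding weight_le_def by blast
  define A' where "A' = {\<alpha>\<in>A. monomial_weight \<alpha> < K}"
  define r where "r x = (\<Sum>\<alpha>\<in>A'. d \<alpha> * monom_fun \<alpha> x)" for x
  have r: "weight_le (K - 1) r"
    unfolding weight_le_def r_def using A
    by (intro exI[of _ A'] exI[of _ d]) (auto simp: A'_def)
  have "K > 0"
  proof (rule ccontr)
    assume "\<not> K > 0"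
    then have "A = {}"
      using A(2) by (auto simp: monomial_weight_pos[THEN gr_implies_not0])
    then show False
      using f ne by simp
  qed
  then have nr: "f \<noteq> r"
    using r min[of "K - 1"] by auto
  show ?thesis
  proof (cases "\<exists>\<alpha>\<in>A. monomial_weight \<alpha> = K")
    case True
    then obtain \<alpha> where \<alpha>: "\<alpha> \<in> A" "monomial_weight \<alpha> = K"
      by blast
    have "A' = A - {\<alpha>}"
    proof (intro equalityI subsetI)
      fix \<beta> assume "\<beta> \<in> A - {\<alpha>}"
      then have "monomial_weight \<beta> \<le> K" "monomial_weight \<beta> \<noteq> K"
        using A(2) \<alpha> injD[OF inj_monomial_weight, of \<beta> \<alpha>] by auto
      then show "\<beta> \<in> A'"
        using \<open>\<beta> \<in> A - {\<alpha>}\<close> by (simp add: A'_def)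
    qed (use \<alpha> in \<open>auto simp: A'_def\<close>)
    then have *: "f x = d \<alpha> * monom_fun \<alpha> x + r x" for x
      unfolding f[rule_format] r_def by (simp only:) (rule sum.remove[OF A(1) \<alpha>(1)])
    have "d \<alpha> \<noteq> 0"
    proof
      assume "d \<alpha> = 0"
      then have "f = r"
        by (intro ext) (simp add: *)
      then show False
        using nr by blast
    qed
    then show ?thesis
      using that[of \<alpha> "d \<alpha>" r] \<alpha> r * by blast
  next
    case False
    then have "A' = A"
      using A(2) by (force simp: A'_def)
    then have "f = r"
      by (intro ext) (simp only: f r_def)
    then show ?thesis
      using nr by blast
  qed
qed

lemma closedin_zariski_separate:
  assumes "closedin zariski V" "x \<notin> V"
  obtains f where "real_polynomial_function f" "\<And>y. y \<in> V \<Longrightarrow> f y = 0" "f x \<noteq> 0"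
proof -
  obtain F where "\<forall>f\<in>F. real_polynomial_function f" "V = {x. \<forall>f\<in>F. f x = 0}"
    using assms(1) unfolding closedin_zariski by blast
  moreover from this obtain f where "f \<in> F" "f x \<noteq> 0"
    using assms(2) by auto
  ultimately show ?thesis
    by (intro that[of f]) auto
qed

text \<open>The leading monomial argument for Hilbert's basis theorem. For every \<open>i\<close> take a polynomial
  separating \<open>V (Suc i)\<close> from \<open>V i\<close> with least possible leading monomial. By Dickson's lemma one of
  these leading monomials divides a later one, and subtracting a multiple cancels the later leading
  term without changing the polynomial on the later set.\<close>

theorem zariski_noetherian:
  fixes V :: "nat \<Rightarrow> (real ^ 'n::finite) set"
  assumes closed: "\<And>i. closedin zariski (V i)"
  shows "\<not> (\<forall>i. V (Suc i) \<subset> V i)"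
proof
  assume dec: "\<forall>i. V (Suc i) \<subset> V i"
  have anti: "V j \<subseteq> V i" if "i \<le> j" for i j
    by (rule lift_Suc_antimono_le[OF _ that]) (use dec in auto)
  define D where "D i f \<longleftrightarrow> real_polynomial_function f \<and> (\<forall>x\<in>V (Suc i). f x = 0) \<and> (\<exists>x\<in>V i. f x \<noteq> 0)"
    for i f
  define N where "N i = (LEAST K. \<exists>f. D i f \<and> weight_le K f)" for i
  have "\<exists>f. D i f \<and> weight_le (N i) f" for i
  proof -
    obtain x where "x \<in> V i" "x \<notin> V (Suc i)"
      using dec by blast
    moreover from closedin_zariski_separate[OF closed this(2)]
    obtain f where "real_polynomial_function f" "\<And>y. y \<in> V (Suc i) \<Longrightarrow> f y = 0" "f x \<noteq> 0"
      by blast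
    ultimately have "D i f"
      unfolding D_def by blast
    moreover obtain K where "weight_le K f"
      using real_polynomial_function_weight_le \<open>D i f\<close> unfolding D_def by blast
    ultimately have "\<exists>K f. D i f \<and> weight_le K f"
      by blast
    then show ?thesis
      unfolding N_def by (rule LeastI_ex)
  qed
  then obtain f where f: "\<And>i. D i (f i)" "\<And>i. weight_le (N i) (f i)"
    by metis
  have min: "\<not> weight_le L g" if "D i g" "L < N i" for i g L
    using that not_less_Least[of L "\<lambda>K. \<exists>f. D i f \<and> weight_le K f"] unfolding N_def by blast
  have "\<exists>\<alpha> c r. monomial_weight \<alpha> = N i \<and> c \<noteq> 0 \<and> weight_le (N i - 1) r \<and>
      (\<forall>x. f i x = c * monom_fun \<alpha> x + r x)" for i
  proof -
    obtain x where "f i x \<noteq> 0"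
      using f(1)[of i] unfolding D_def by blast
    then show ?thesis
      using weight_le_leading_monomial[OF f(2), of i x] min[OF f(1)] by metis
  qed
  then obtain \<alpha> c r where lead: "\<And>i. monomial_weight (\<alpha> i) = N i" "\<And>i. c i \<noteq> 0"
    "\<And>i. weight_le (N i - 1) (r i)" "\<And>i x. f i x = c i * monom_fun (\<alpha> i) x + r i x"
    by metis
  obtain s where s: "strict_mono s" "\<And>k. incseq (\<lambda>n. \<alpha> (s n) k)"
    using dickson[of UNIV \<alpha>] by auto
  define i j where "i = s 0" and "j = s 1"
  have ij: "i < j" "\<And>k. \<alpha> i k \<le> \<alpha> j k"
    using s(1) incseqD[OF s(2), of 0 1] by (auto simp: i_def j_def strict_mono_def)
  define \<delta> where "\<delta> k = \<alpha> j k - \<alpha> i k" for k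
  have \<alpha>j: "\<alpha> j = (\<lambda>k. \<delta> k + \<alpha> i k)"
    using ij(2) by (auto simp: \<delta>_def)
  have Nj: "N j = monomial_weight \<delta> * N i"
    using lead(1)[of j] unfolding \<alpha>j monomial_weight_add lead(1) by simp
  define g where "g x = f j x + (- (c j / c i)) * monom_fun \<delta> x * f i x" for x
  have g: "g x = r j x + (- (c j / c i)) * monom_fun \<delta> x * r i x" for x
    using lead(2)[of i] by (simp add: g_def lead(4) \<alpha>j monom_fun_add field_simps)
  have pos: "N i > 0" "monomial_weight \<delta> > 0"
    using monomial_weight_pos[of "\<alpha> i"] monomial_weight_pos[of \<delta>] by (auto simp: lead(1))
  have "monomial_weight \<delta> * (N i - 1) \<le> N j - 1"
    unfolding Nj using pos by (simp add: diff_mult_distrib2 diff_le_mono2)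
  then have "weight_le (N j - 1) g"
    unfolding g[abs_def]
    by (intro weight_le_add lead(3) weight_le_mono[OF weight_le_monom_mult[OF lead(3)]])
  moreover have "D j g"
  proof -
    have "real_polynomial_function g"
      unfolding g_def using f(1) unfolding D_def
      by (intro real_polynomial_function.intros(2-4) real_polynomial_function_monom_fun) auto
    moreover have "f i x = 0" if "x \<in> V j" for x
      using f(1)[of i] anti[of "Suc i" j] ij(1) that unfolding D_def by auto
    moreover have "V (Suc j) \<subseteq> V j"
      using dec by blast
    ultimately show ?thesis
      using f(1)[of j] unfolding D_def g_def by auto
  qed
  moreover have "N j - 1 < N j"
    using pos by (simp add: Nj)
  ultimately show False
    using min by blast
qed

section \<open>Elimination of one variable\<close>

text \<open>The set \<open>S\<close> plays the role of a graph over a base \<open>H\<close> that it dominates: a polynomial in the base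
  variables alone vanishes on \<open>H\<close> as soon as it vanishes on the projection of \<open>S\<close>. Among the
  polynomials vanishing on \<open>S\<close>, let \<open>F\<close> be one of least degree \<open>e\<close> in the last variable, with
  leading coefficient \<open>c\<close>. Every relation of smaller degree is trivial, and this single fact is used
  twice: the product of \<open>c\<close> and the derivative of \<open>F\<close> has degree \<open>e - 1\<close> and hence cannot vanish on
  \<open>S\<close>; and pseudo-division by \<open>F\<close> leaves a trivial remainder, so that every \<open>G\<close> vanishing on \<open>S\<close>
  also vanishes where \<open>F = 0\<close> and \<open>c \<noteq> 0\<close>.\<close>

lemma elimination:
  fixes S :: "('a::euclidean_space \<times> real) set" and H :: "'a set"
  assumes S: "fst ` S \<subseteq> H"
    and indep: "\<forall>c. real_polynomial_function c \<longrightarrow> (\<forall>v\<in>fst ` S. c v = 0) \<longrightarrow> (\<forall>u\<in>H. c u = 0)"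
    and G0: "real_polynomial_function G0" "\<And>w. w \<in> S \<Longrightarrow> G0 w = 0" "u0 \<in> H" "G0 (u0, z0) \<noteq> 0"
  obtains F F' c u\<^sub>0 z\<^sub>0 where "real_polynomial_function F" "real_polynomial_function c"
    "\<And>w. w \<in> S \<Longrightarrow> F w = 0"
    "\<And>u z. ((\<lambda>z. F (u, z)) has_real_derivative F' (u, z)) (at z)"
    "(u\<^sub>0, z\<^sub>0) \<in> S" "c u\<^sub>0 \<noteq> 0" "F' (u\<^sub>0, z\<^sub>0) \<noteq> 0"
    "\<And>G u z. real_polynomial_function G \<Longrightarrow> (\<And>w. w \<in> S \<Longrightarrow> G w = 0) \<Longrightarrow> u \<in> H \<Longrightarrow>
       F (u, z) = 0 \<Longrightarrow> c u \<noteq> 0 \<Longrightarrow> G (u, z) = 0"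
proof -
  define vanishes where "vanishes e c \<longleftrightarrow> (\<forall>k. real_polynomial_function (c k)) \<and>
      (\<forall>(u, z)\<in>S. (\<Sum>k\<le>e. c k u * z ^ k) = 0)" for e :: nat and c :: "nat \<Rightarrow> 'a \<Rightarrow> real"
  define relation where "relation e \<longleftrightarrow> (\<exists>c. vanishes e c \<and> (\<exists>u\<in>H. c e u \<noteq> 0))" for e
  have drop: "\<forall>k\<le>N. \<forall>u\<in>H. c k u = 0"
    if "vanishes N c" "\<And>e. e \<le> N \<Longrightarrow> \<not> relation e" for N c
    using that
  proof (induction N)
    case 0
    then have "\<not> relation 0"
      by simp
    then show ?case
      using 0(1) unfolding relation_def by auto
  next
    case (Suc N)
    have "\<not> relation (Suc N)"
      using Suc.prems(2) by simp
    then have top: "\<forall>u\<in>H. c (Suc N) u = 0"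
      using Suc.prems(1) unfolding relation_def by auto
    have "vanishes N c"
      using Suc.prems(1) top S by (force simp: vanishes_def)
    then have "\<forall>k\<le>N. \<forall>u\<in>H. c k u = 0"
      using Suc.prems(2) by (intro Suc.IH) auto
    then show ?case
      using top le_Suc_eq by auto
  qed
  have "\<exists>e. relation e"
  proof (rule ccontr)
    assume none: "\<nexists>e. relation e"
    obtain N g where g: "\<And>k. real_polynomial_function (g k)"
      "\<And>u z. G0 (u, z) = (\<Sum>k\<le>N. g k u * z ^ k)"
      using real_polynomial_function_last_variable[OF G0(1)] by metis
    have "(\<Sum>k\<le>N. g k u * z ^ k) = 0" if "(u, z) \<in> S" for u z
      using G0(2)[OF that] by (simp only: g(2))
    then have "vanishes N g"
      unfolding vanishes_def using g(1) by blast
    then have "\<forall>k\<le>N. \<forall>u\<in>H. g k u = 0"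
      by (rule drop) (use none in blast)
    then have "G0 (u0, z0) = 0"
      using G0(3) by (simp add: g(2))
    then show False
      using G0(4) by simp
  qed
  define e where "e = (LEAST e. relation e)"
  have "relation e" and min: "\<And>k. k < e \<Longrightarrow> \<not> relation k"
    unfolding e_def using \<open>\<exists>e. relation e\<close> by (blast intro: LeastI_ex dest: not_less_Least)+
  then obtain c u\<^sub>1 where c: "vanishes e c" and u1: "u\<^sub>1 \<in> H" "c e u\<^sub>1 \<noteq> 0"
    unfolding relation_def by blast
  have poly: "real_polynomial_function (c k)" for k
    using c by (simp add: vanishes_def)
  have e: "e > 0"
  proof (rule ccontr)
    assume "\<not> e > 0"
    then have "c 0 v = 0" if "v \<in> fst ` S" for v
      using c that by (auto simp: vanishes_def)
    then have "c 0 u\<^sub>1 = 0"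
      using indep poly u1(1) by blast
    then show False
      using u1(2) \<open>\<not> e > 0\<close> by simp
  qed
  define F where "F w = (\<Sum>k\<le>e. c k (fst w) * snd w ^ k)" for w
  define F' where "F' w = (\<Sum>k\<le>e - 1. real (Suc k) * c (Suc k) (fst w) * snd w ^ k)" for w
  have poly_F: "real_polynomial_function F"
    unfolding F_def
    by (intro real_polynomial_function_sum real_polynomial_function.intros(4)
        real_polynomial_function_comp[OF _ poly] real_polynomial_function_power
        real_polynomial_function.intros(1) polynomial_function_bounded_linear
        bounded_linear_fst bounded_linear_snd) auto
  have F_S: "F w = 0" if "w \<in> S" for w
    using c that by (auto simp: F_def vanishes_def)
  have deriv: "((\<lambda>z. F (u, z)) has_real_derivative F' (u, z)) (at z)" for u z
  proof -
    have "((\<lambda>z. \<Sum>k\<le>e. c k u * z ^ k) has_real_derivative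
        (\<Sum>k\<le>e. c k u * (real k * z ^ (k - 1)))) (at z)"
      by (intro DERIV_sum) (auto intro!: derivative_eq_intros)
    moreover have "(\<Sum>k\<le>e. c k u * (real k * z ^ (k - 1))) = F' (u, z)"
    proof -
      have "{..e} = insert 0 (Suc ` {..e - 1})"
        using e by (auto simp: image_Suc_atMost)
      then have "(\<Sum>k\<le>e. c k u * (real k * z ^ (k - 1))) =
          (\<Sum>k\<in>Suc ` {..e - 1}. c k u * (real k * z ^ (k - 1)))"
        by simp
      also have "\<dots> = F' (u, z)"
        by (subst sum.reindex) (simp_all add: F'_def mult_ac)
      finally show ?thesis .
    qed
    ultimately show ?thesis
      by (simp add: F_def)
  qed
  \<comment> \<open>The coefficient of degree \<open>e - 1\<close> in the product is \<open>e\<close> times the square of the leading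
    coefficient, so the product is a nontrivial polynomial of degree below \<open>e\<close>.\<close>
  have "\<exists>(u, z)\<in>S. c e u * F' (u, z) \<noteq> 0"
  proof (rule ccontr)
    assume 0: "\<not> ?thesis"
    define d where "d k u = c e u * (real (Suc k) * c (Suc k) u)" for k u
    have "real_polynomial_function (d k)" for k
      unfolding d_def by (intro real_polynomial_function.intros(2,4) poly)
    moreover have "(\<Sum>k\<le>e - 1. d k u * z ^ k) = c e u * F' (u, z)" for u z
      by (simp add: d_def F'_def sum_distrib_left mult_ac)
    ultimately have "vanishes (e - 1) d"
      using 0 by (auto simp: vanishes_def)
    moreover have "d (e - 1) u\<^sub>1 \<noteq> 0"
      using e u1(2) by (simp add: d_def)
    ultimately have "relation (e - 1)"
      unfolding relation_def using u1(1) by blast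
    then show False
      using min[of "e - 1"] e by simp
  qed
  then obtain u\<^sub>0 z\<^sub>0 where S0: "(u\<^sub>0, z\<^sub>0) \<in> S" "c e u\<^sub>0 \<noteq> 0" "F' (u\<^sub>0, z\<^sub>0) \<noteq> 0"
    by auto
  have division: "(\<Sum>k\<le>N. g k u * z ^ k) = 0"
    if "vanishes N g" "u \<in> H" "F (u, z) = 0" "c e u \<noteq> 0" for N g u z
    using that(1)
  proof (induction N arbitrary: g)
    case (0 g)
    have "\<forall>k\<le>0. \<forall>u\<in>H. g k u = 0"
      using 0 by (rule drop) (use min e in auto)
    then show ?case
      using that(2) by simp
  next
    case (Suc N g)
    show ?case
    proof (cases "Suc N < e")
      case True
      have "\<forall>k\<le>Suc N. \<forall>u\<in>H. g k u = 0"
        using Suc.prems by (rule drop) (use min True in auto)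
      then show ?thesis
        using that(2) by simp
    next
      case False
      \<comment> \<open>One step of pseudo-division: \<open>c e \<cdot> G - g\<^sub>N\<^sub>+\<^sub>1 \<cdot> z\<^sup>m \<cdot> F\<close> has degree at most \<open>N\<close>.\<close>
      define m where "m = Suc N - e"
      define h where "h k u = c e u * g k u - g (Suc N) u * (if k < m then 0 else c (k - m) u)" for k u
      have shift: "(\<Sum>k\<le>Suc N. (if k < m then 0 else c (k - m) u) * z ^ k) = z ^ m * F (u, z)" for u z
      proof -
        have "(\<Sum>k\<le>Suc N. (if k < m then 0 else c (k - m) u) * z ^ k) =
            (\<Sum>k\<in>{m..Suc N}. c (k - m) u * z ^ k)"
          by (rule sum.mono_neutral_cong_right) auto
        also have "\<dots> = (\<Sum>k\<in>{0 + m..e + m}. c (k - m) u * z ^ k)"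
          using False by (simp add: m_def)
        also have "\<dots> = (\<Sum>k\<le>e. c k u * z ^ (k + m))"
          by (subst sum.shift_bounds_cl_nat_ivl) (simp add: atLeast0AtMost)
        also have "\<dots> = z ^ m * F (u, z)"
          by (simp add: F_def sum_distrib_left power_add mult_ac)
        finally show ?thesis .
      qed
      have "h (Suc N) u = 0" for u
        using False by (simp add: h_def m_def)
      then have "(\<Sum>k\<le>N. h k u * z ^ k) = (\<Sum>k\<le>Suc N. h k u * z ^ k)" for u z
        by simp
      also have "\<dots> u z = c e u * (\<Sum>k\<le>Suc N. g k u * z ^ k) -
          g (Suc N) u * (\<Sum>k\<le>Suc N. (if k < m then 0 else c (k - m) u) * z ^ k)" for u z
        by (simp only: h_def left_diff_distrib sum_subtractf sum_distrib_left mult.assoc)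
      finally have h: "(\<Sum>k\<le>N. h k u * z ^ k) = c e u * (\<Sum>k\<le>Suc N. g k u * z ^ k) -
          g (Suc N) u * (z ^ m * F (u, z))" for u z
        unfolding shift .
      have g: "real_polynomial_function (g k)" for k
        using Suc.prems by (simp add: vanishes_def)
      have "real_polynomial_function (h k)" for k
      proof (cases "k < m")
        case True
        then show ?thesis
          unfolding h_def by (simp add: real_polynomial_function.intros(4) poly g)
      next
        case False
        then show ?thesis
          unfolding h_def
          by (simp add: real_polynomial_function.intros(4) real_polynomial_function_diff poly g)
      qed
      moreover have "(\<Sum>k\<le>N. h k u * z ^ k) = 0" if "(u, z) \<in> S" for u z
        using Suc.prems that F_S[OF that] by (auto simp: h vanishes_def)
      ultimately have "vanishes N h"
        by (auto simp: vanishes_def)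
      then have "(\<Sum>k\<le>N. h k u * z ^ k) = 0"
        by (rule Suc.IH)
      then show ?thesis
        using that(3,4) by (simp add: h)
    qed
  qed
  have "G (u, z) = 0" if G: "real_polynomial_function G" "\<And>w. w \<in> S \<Longrightarrow> G w = 0"
    and uz: "u \<in> H" "F (u, z) = 0" "c e u \<noteq> 0" for G u z
  proof -
    obtain N g where g: "\<And>k. real_polynomial_function (g k)"
      "\<And>u z. G (u, z) = (\<Sum>k\<le>N. g k u * z ^ k)"
      using real_polynomial_function_last_variable[OF G(1)] by metis
    have "(\<Sum>k\<le>N. g k u * z ^ k) = 0" if "(u, z) \<in> S" for u z
      using G(2)[OF that] by (simp only: g(2))
    then have "vanishes N g"
      unfolding vanishes_def using g(1) by blast
    then show ?thesis
      unfolding g(2) by (rule division[OF _ uz])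
  qed
  then show ?thesis
    using that[OF poly_F poly F_S deriv S0] by blast
qed

section \<open>Relations among generic linear forms\<close>

definition restrict_coords :: "'r::finite set \<Rightarrow> real ^ 'r \<Rightarrow> real ^ 'r" where
  "restrict_coords J y = (\<chi> i. if i \<in> J then y $ i else 0)"

lemma restrict_coords_nth [simp]: "restrict_coords J y $ i = (if i \<in> J then y $ i else 0)"
  by (simp add: restrict_coords_def)

lemma restrict_coords_idem [simp]: "restrict_coords J (restrict_coords J y) = restrict_coords J y"
  by (simp add: vec_eq_iff)

lemma bounded_linear_restrict_coords: "bounded_linear (restrict_coords J)"
  unfolding linear_conv_bounded_linear[symmetric] by (rule linearI) (simp_all add: vec_eq_iff)

lemma polynomial_function_restrict_coords:
  "polynomial_function f \<Longrightarrow> polynomial_function (\<lambda>x. restrict_coords J (f x))"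
  by (rule polynomial_function_comp_linear[OF bounded_linear_restrict_coords])

lemma restrict_coords_insert:
  "j \<notin> J \<Longrightarrow> restrict_coords (insert j J) y = restrict_coords J y + (y $ j) *\<^sub>R axis j 1"
  by (auto simp: vec_eq_iff axis_def)

text \<open>\<open>F\<close> is applied to restricted vectors instead of being required to depend on the coordinates in \<open>J\<close>
  only; this keeps one type of rows while \<open>J\<close> varies.\<close>

definition generic_relation :: "(real ^ 'n::finite) set \<Rightarrow> 'r::finite set \<Rightarrow> bool" where
  "generic_relation X J \<longleftrightarrow>
     (\<exists>F :: (real ^ 'n ^ 'r) \<times> (real ^ 'r) \<Rightarrow> real. real_polynomial_function F \<and>
       (\<exists>A y. F (A, restrict_coords J y) \<noteq> 0) \<and>
       (\<forall>A. \<forall>x\<in>X. F (A, restrict_coords J (A *v x)) = 0))"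

lemma generic_relationI:
  fixes F :: "(real ^ 'n::finite ^ 'r::finite) \<times> (real ^ 'r) \<Rightarrow> real"
  assumes "real_polynomial_function F" "F (A, restrict_coords J y) \<noteq> 0"
    and "\<And>A x. x \<in> X \<Longrightarrow> F (A, restrict_coords J (A *v x)) = 0"
  shows "generic_relation X J"
  unfolding generic_relation_def using assms by (intro exI[of _ F]) auto

lemma not_generic_relationD:
  fixes F :: "(real ^ 'n::finite ^ 'r::finite) \<times> (real ^ 'r) \<Rightarrow> real"
  assumes "\<not> generic_relation X J" "real_polynomial_function F"
    and "\<And>A x. x \<in> X \<Longrightarrow> F (A, restrict_coords J (A *v x)) = 0"
  shows "F (A, restrict_coords J y) = 0"
  using generic_relationI[OF assms(2) _ assms(3)] assms(1) by blast

text \<open>The empty set of rows has no relation, since it would be a nonzero polynomial in \<open>A\<close> that is zero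
  for every \<open>A\<close>. Adding rows one at a time, there is a first one that creates a relation.\<close>

lemma generic_relation_critical:
  fixes J0 :: "'r::finite set"
  assumes "generic_relation X J0" "X \<noteq> {}"
  obtains J :: "'r set" and j where "j \<notin> J" "\<not> generic_relation X J" "generic_relation X (insert j J)"
proof -
  have "generic_relation X J0 \<Longrightarrow>
      \<exists>(J :: 'r set) j. j \<notin> J \<and> \<not> generic_relation X J \<and> generic_relation X (insert j J)"
  proof (induction J0 rule: finite_induct[OF finite])
    case 1
    have "restrict_coords {} y = 0" for y :: "real ^ 'r"
      by (simp add: vec_eq_iff)
    then have "\<not> generic_relation X ({} :: 'r set)"
      using assms(2) by (auto simp: generic_relation_def)
    then show ?case
      using 1 by blast
  next
    case (2 j J)
    then show ?case
      by blast
  qed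
  then show ?thesis
    using assms(1) that by blast
qed

text \<open>The point over \<open>x\<close> on the graph to which elimination is applied: the matrix and the values of the
  forms in \<open>J\<close> are the base variables, and the value of the form \<open>j\<close> is the variable to be
  eliminated.\<close>

definition form_value ::
  "'r::finite set \<Rightarrow> 'r \<Rightarrow> real ^ 'n::finite ^ 'r \<Rightarrow> real ^ 'n \<Rightarrow> ((real ^ 'n ^ 'r) \<times> (real ^ 'r)) \<times> real" where
  "form_value J j A x = ((A, restrict_coords J (A *v x)), (A *v x) $ j)"

text \<open>Since \<open>F\<close> vanishes at \<open>form_value J j A x\<close> for all matrices \<open>A\<close>, it stays zero when the entry of
  \<open>A\<close> in row \<open>j\<close> and column \<open>i\<close> is moved. This changes the \<open>j\<close>-th form by a multiple of \<open>x $ i\<close> and no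
  other form. Hence the derivative in the matrix direction plus \<open>x $ i\<close> times the derivative \<open>q\<close> in
  the last variable is zero, which expresses \<open>x $ i\<close> rationally. The last conclusion says that the
  hypersurface \<open>F = 0\<close> satisfies, away from \<open>c = 0\<close>, every equation of the graph.\<close>

lemma birational_hypersurface:
  fixes X :: "(real ^ 'n::finite) set" and J :: "'r::finite set"
  assumes j: "j \<notin> J" and indep: "\<not> generic_relation X J" and dep: "generic_relation X (insert j J)"
  obtains F q p c A0 x0 where "real_polynomial_function F" "real_polynomial_function q"
    "polynomial_function p" "real_polynomial_function c"
    "\<And>A x. x \<in> X \<Longrightarrow> F (form_value J j A x) = 0"
    "\<And>A x. x \<in> X \<Longrightarrow> p (form_value J j A x) = q (form_value J j A x) *\<^sub>R x"
    "\<And>u z. ((\<lambda>z. F (u, z)) has_real_derivative q (u, z)) (at z)"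
    "x0 \<in> X" "q (form_value J j A0 x0) \<noteq> 0" "c (A0, restrict_coords J (A0 *v x0)) \<noteq> 0"
    "\<forall>G. real_polynomial_function G \<longrightarrow> (\<forall>A. \<forall>x\<in>X. G (form_value J j A x) = 0) \<longrightarrow>
       (\<forall>A y z. F ((A, restrict_coords J y), z) = 0 \<longrightarrow> c (A, restrict_coords J y) \<noteq> 0 \<longrightarrow>
         G ((A, restrict_coords J y), z) = 0)"
proof -
  define S where "S = {form_value J j A x |A x. x \<in> X}"
  define H where "H = {(A :: real ^ 'n ^ 'r, restrict_coords J y) |A y. True}"
  have fst_S: "fst ` S = {(A, restrict_coords J (A *v x)) |A x. x \<in> X}"
    by (force simp: S_def form_value_def)
  obtain R A1 y1 where R: "real_polynomial_function (R :: (real ^ 'n ^ 'r) \<times> (real ^ 'r) \<Rightarrow> real)"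
    "R (A1, restrict_coords (insert j J) y1) \<noteq> 0"
    "\<And>A x. x \<in> X \<Longrightarrow> R (A, restrict_coords (insert j J) (A *v x)) = 0"
    using dep unfolding generic_relation_def by blast
  define G0 where "G0 w = R (fst (fst w), snd (fst w) + snd w *\<^sub>R axis j 1)" for w
  have poly_G0: "real_polynomial_function G0"
    unfolding G0_def
    by (rule real_polynomial_function_comp[OF _ R(1)])
      (intro polynomial_intros polynomial_function_mult)
  have G0_S: "G0 w = 0" if "w \<in> S" for w
    using that R(3) j by (auto simp: S_def form_value_def G0_def restrict_coords_insert)
  have G0_ne: "G0 ((A1, restrict_coords J y1), y1 $ j) \<noteq> 0"
    using R(2) j by (simp add: G0_def restrict_coords_insert)
  have S_H: "fst ` S \<subseteq> H"
    unfolding fst_S H_def by blast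
  have indep_c: "\<forall>c. real_polynomial_function c \<longrightarrow> (\<forall>v\<in>fst ` S. c v = 0) \<longrightarrow> (\<forall>u\<in>H. c u = 0)"
  proof (intro allI impI ballI)
    fix c u
    assume c: "real_polynomial_function c" "\<forall>v\<in>fst ` S. c v = 0" and u: "u \<in> H"
    have "c (A, restrict_coords J y) = 0" for A y
      by (rule not_generic_relationD[OF indep c(1)], rule c(2)[rule_format]) (auto simp: fst_S)
    then show "c u = 0"
      using u by (auto simp: H_def)
  qed
  have H1: "(A1, restrict_coords J y1) \<in> H"
    by (auto simp: H_def)
  show ?thesis
  proof (rule elimination[of S H G0 "(A1, restrict_coords J y1)" "y1 $ j",
        OF S_H indep_c poly_G0 G0_S H1 G0_ne])
    fix F F' c u0 z0
    assume F: "real_polynomial_function F" "real_polynomial_function c"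
      "\<And>w. w \<in> S \<Longrightarrow> F w = 0"
      "\<And>u z. ((\<lambda>z. F (u, z)) has_real_derivative F' (u, z)) (at z)"
      "(u0, z0) \<in> S" "c u0 \<noteq> 0" "F' (u0, z0) \<noteq> 0"
      "\<And>G u z. real_polynomial_function G \<Longrightarrow> (\<And>w. w \<in> S \<Longrightarrow> G w = 0) \<Longrightarrow> u \<in> H \<Longrightarrow>
         F (u, z) = 0 \<Longrightarrow> c u \<noteq> 0 \<Longrightarrow> G (u, z) = 0"
    obtain D where D: "\<And>v. real_polynomial_function (\<lambda>w. D w v)" "\<And>w. (F has_derivative D w) (at w)"
      using real_polynomial_function_has_derivative[OF F(1)] by metis
    have lin: "linear (D w)" for w
      using D(2) has_derivative_linear by blast
    have F': "F' (u, z) = D (u, z) (0, 1)" for u z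
    proof -
      have "((\<lambda>z. (u, z)) has_derivative (\<lambda>t. (0, t))) (at z)"
        by (auto intro!: derivative_eq_intros)
      from has_derivative_compose[OF this D(2)]
      have "((\<lambda>z. F (u, z)) has_derivative (\<lambda>t. D (u, z) (0, t))) (at z)" .
      moreover have "(\<lambda>t. D (u, z) (0, t)) = (*) (D (u, z) (0, 1))"
      proof
        show "D (u, z) (0, t) = D (u, z) (0, 1) * t" for t
          using linear_scale[OF lin, of "(u, z)" t "(0, 1)"] by simp
      qed
      ultimately have "((\<lambda>z. F (u, z)) has_real_derivative D (u, z) (0, 1)) (at z)"
        unfolding has_field_derivative_def by (simp only:)
      then show ?thesis
        using F(4) DERIV_unique by blast
    qed
    define E where "E i = (axis j (axis i 1) :: real ^ 'n ^ 'r)" for i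
    define q where "q w = D w (0, 1)" for w
    define p where "p w = (\<chi> i. - D w ((E i, 0), 0))" for w
    have poly_p: "polynomial_function p"
    proof (rule polynomial_function_vec)
      fix i
      show "polynomial_function (\<lambda>w. p w $ i)"
        unfolding p_def vec_lambda_beta real_polynomial_function_eq[symmetric]
        by (intro real_polynomial_function_minus D(1))
    qed
    have inverse: "p (form_value J j A x) = q (form_value J j A x) *\<^sub>R x" if x: "x \<in> X" for A x
    proof -
      have "p (form_value J j A x) $ i = (q (form_value J j A x) *\<^sub>R x) $ i" for i
      proof -
        have mult: "(A + t *\<^sub>R E i) *v x = A *v x + (t * x $ i) *\<^sub>R axis j 1" for t
        proof -
          have "E i *v x = (x $ i) *\<^sub>R axis j 1"
            unfolding vec_eq_iff
          proof
            fix k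
            have "E i $ k = (if k = j then axis i 1 else 0)"
              by (simp add: E_def axis_def)
            then show "(E i *v x) $ k = ((x $ i) *\<^sub>R axis j 1) $ k"
              by (simp add: matrix_vector_mul_component inner_axis' axis_def[of j])
          qed
          then show ?thesis
            by (simp add: matrix_vector_mult_add_rdistrib scaleR_matrix_vector_assoc[symmetric])
        qed
        have line: "form_value J j (A + t *\<^sub>R E i) x = form_value J j A x + t *\<^sub>R ((E i, 0), x $ i)" for t
        proof -
          have "restrict_coords J (A *v x + (t * x $ i) *\<^sub>R axis j 1) = restrict_coords J (A *v x)"
            using j by (auto simp: vec_eq_iff axis_def)
          then show ?thesis
            by (simp add: form_value_def mult)
        qed
        define b where "b = form_value J j A x"
        define v where "v = ((E i, 0 :: real ^ 'r), x $ i)"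
        have "((\<lambda>t. b + t *\<^sub>R v) has_derivative (\<lambda>t. t *\<^sub>R v)) (at 0)"
          by (auto intro!: derivative_eq_intros)
        moreover have "(F has_derivative D b) (at (b + 0 *\<^sub>R v))"
          using D(2)[of b] by simp
        ultimately have "((\<lambda>t. F (b + t *\<^sub>R v)) has_derivative (\<lambda>t. D b (t *\<^sub>R v))) (at 0)"
          by (rule has_derivative_compose)
        moreover have "F (b + t *\<^sub>R v) = 0" for t
          unfolding line[symmetric] b_def v_def using x by (intro F(3)) (auto simp: S_def)
        ultimately have "((\<lambda>t :: real. 0 :: real) has_derivative (\<lambda>t. D b (t *\<^sub>R v))) (at 0)"
          by simp
        then have "(\<lambda>t. D b (t *\<^sub>R v)) = (\<lambda>t. 0)"
          by (rule has_derivative_unique[OF _ has_derivative_const])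
        then have "D b (1 *\<^sub>R v) = 0"
          by (rule fun_cong)
        moreover have "1 *\<^sub>R v = ((E i, 0), 0) + x $ i *\<^sub>R (0, 1)"
          by (simp add: v_def)
        ultimately have "D b (((E i, 0), 0) + x $ i *\<^sub>R (0, 1)) = 0"
          by (simp only:)
        then have "D b ((E i, 0), 0) + x $ i * q b = 0"
          by (simp only: linear_add[OF lin] linear_scale[OF lin] q_def real_scaleR_def)
        then have "p b $ i = (q b *\<^sub>R x) $ i"
          by (simp add: p_def mult.commute minus_unique)
        then show ?thesis
          by (simp only: b_def)
      qed
      then show ?thesis
        by (simp add: vec_eq_iff)
    qed
    obtain A0 x0 where A0: "x0 \<in> X" "(u0, z0) = form_value J j A0 x0"
      using F(5) by (auto simp: S_def)
    have "q (form_value J j A0 x0) \<noteq> 0" "c (A0, restrict_coords J (A0 *v x0)) \<noteq> 0"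
      using F(6,7) A0(2) by (auto simp: form_value_def q_def F')
    moreover have "G ((A, restrict_coords J y), z) = 0"
      if "real_polynomial_function G" "\<forall>A. \<forall>x\<in>X. G (form_value J j A x) = 0"
        "F ((A, restrict_coords J y), z) = 0" "c (A, restrict_coords J y) \<noteq> 0" for G A y z
      by (rule F(8)) (use that in \<open>auto simp: S_def H_def\<close>)
    moreover have "((\<lambda>z. F (u, z)) has_real_derivative q (u, z)) (at z)" for u z
      using F(4)[of u z] unfolding F' q_def .
    moreover have "F (form_value J j A x) = 0" if "x \<in> X" for A x
      by (rule F(3)) (use that in \<open>auto simp: S_def\<close>)
    moreover have "real_polynomial_function q"
      unfolding q_def by (rule D(1))
    ultimately show ?thesis
      by (intro that[of F q p c x0 A0] F(1,2) poly_p inverse A0(1)) auto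
  qed
qed

text \<open>Fix the matrix of a point where \<open>q\<close> and \<open>c\<close> do not vanish. At this point \<open>F\<close> has a simple root in
  the last variable, so it changes sign, and by the intermediate value theorem every nearby \<open>y\<close>
  extends to a zero \<open>((A, y), z)\<close> of \<open>F\<close> with \<open>q \<noteq> 0\<close> and \<open>c \<noteq> 0\<close>. The point \<open>p / q\<close> belonging to
  it lies in \<open>X\<close> and projects to \<open>y\<close>, because both facts are polynomial equations that hold on the
  graph.\<close>

lemma projection_contains_ball:
  fixes X :: "(real ^ 'n::finite) set" and J :: "'r::finite set"
  assumes X: "closedin zariski X"
    and j: "j \<notin> J" and indep: "\<not> generic_relation X J" and dep: "generic_relation X (insert j J)"
  obtains A y0 r where "r > 0" "restrict_coords J y0 = y0"
    "\<And>y. restrict_coords J y = y \<Longrightarrow> dist y y0 < r \<Longrightarrow> \<exists>x\<in>X. restrict_coords J (A *v x) = y"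
proof (rule birational_hypersurface[OF j indep dep])
  fix F q p c A x0
  assume poly: "real_polynomial_function F" "real_polynomial_function q"
    "polynomial_function p" "real_polynomial_function c"
    and F_X: "\<And>A x. x \<in> X \<Longrightarrow> F (form_value J j A x) = 0"
    and pq: "\<And>A x. x \<in> X \<Longrightarrow> p (form_value J j A x) = q (form_value J j A x) *\<^sub>R x"
    and deriv: "\<And>u z. ((\<lambda>z. F (u, z)) has_real_derivative q (u, z)) (at z)"
    and x0: "x0 \<in> X" "q (form_value J j A x0) \<noteq> 0" "c (A, restrict_coords J (A *v x0)) \<noteq> 0"
    and local: "\<forall>G. real_polynomial_function G \<longrightarrow> (\<forall>A. \<forall>x\<in>X. G (form_value J j A x) = 0) \<longrightarrow>
       (\<forall>A y z. F ((A, restrict_coords J y), z) = 0 \<longrightarrow> c (A, restrict_coords J y) \<noteq> 0 \<longrightarrow>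
         G ((A, restrict_coords J y), z) = 0)"
  define y0 where "y0 = restrict_coords J (A *v x0)"
  define z0 where "z0 = (A *v x0) $ j"
  have w0: "form_value J j A x0 = ((A, y0), z0)"
    by (simp add: form_value_def y0_def z0_def)
  define q0 where "q0 = q ((A, y0), z0)"
  have q0: "q0 \<noteq> 0"
    using x0(2) by (simp add: q0_def w0)
  have cont: "continuous_on UNIV (\<lambda>y. g ((A, y), z))" if "real_polynomial_function g" for g z
    by (intro continuous_on_real_polynomial_function real_polynomial_function_comp[OF _ that]
        polynomial_intros)
  define good where "good = {w. q w * c (fst w) \<noteq> 0}"
  have "open good"
    unfolding good_def
    by (intro open_neq_0_real_polynomial_function real_polynomial_function.intros(4) poly
        real_polynomial_function_comp[OF _ poly(4)] polynomial_intros)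
  moreover have "((A, y0), z0) \<in> good"
    using x0(2,3) by (simp add: good_def w0 y0_def[symmetric])
  ultimately obtain e where e: "e > 0" "ball ((A, y0), z0) e \<subseteq> good"
    by (meson openE)
  \<comment> \<open>The factor \<open>q0\<close> makes the derivative at \<open>z0\<close> positive, whatever the sign of \<open>q0\<close>.\<close>
  have "((\<lambda>z. q0 * F ((A, y0), z)) has_real_derivative q0 * q0) (at z0)"
    unfolding q0_def by (intro DERIV_cmult deriv)
  moreover have "q0 * q0 > 0"
    using q0 by (auto simp: zero_less_mult_iff)
  moreover have F0: "F ((A, y0), z0) = 0"
    using F_X[OF x0(1), of A] by (simp add: w0)
  ultimately obtain d1 d2 where d: "d1 > 0" "\<And>h. h > 0 \<Longrightarrow> h < d1 \<Longrightarrow> q0 * F ((A, y0), z0 + h) > 0"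
    "d2 > 0" "\<And>h. h > 0 \<Longrightarrow> h < d2 \<Longrightarrow> q0 * F ((A, y0), z0 - h) < 0"
    using DERIV_pos_inc_right[of "\<lambda>z. q0 * F ((A, y0), z)" "q0 * q0" z0]
      DERIV_pos_inc_left[of "\<lambda>z. q0 * F ((A, y0), z)" "q0 * q0" z0] by auto
  define h where "h = min (min d1 d2) e / 2"
  have h: "h > 0" "h < d1" "h < d2" "h \<le> e / 2"
    using d(1,3) e(1) by (auto simp: h_def)
  define T where "T = {y. q0 * F ((A, y), z0 + h) > 0} \<inter> {y. q0 * F ((A, y), z0 - h) < 0}"
  have "open T"
    unfolding T_def
    by (intro open_Int open_Collect_less continuous_on_const continuous_on_mult_left cont poly)
  moreover have "y0 \<in> T"
    using d h by (simp add: T_def)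
  ultimately obtain r0 where r0: "r0 > 0" "ball y0 r0 \<subseteq> T"
    by (meson openE)
  define r where "r = min r0 (e / 2)"
  have "\<exists>x\<in>X. restrict_coords J (A *v x) = y" if y: "restrict_coords J y = y" "dist y y0 < r" for y
  proof -
    have "y \<in> T"
      using r0(2) y(2) by (auto simp: r_def dist_commute)
    moreover have "continuous_on {z0 - h..z0 + h} (\<lambda>z. q0 * F ((A, y), z))"
      by (intro continuous_on_mult_left continuous_on_real_polynomial_function
          real_polynomial_function_comp[OF _ poly(1)] polynomial_intros)
    ultimately obtain z where z: "z0 - h \<le> z" "z \<le> z0 + h" "q0 * F ((A, y), z) = 0"
      using IVT'[of "\<lambda>z. q0 * F ((A, y), z)" "z0 - h" 0 "z0 + h"] h(1) by (auto simp: T_def)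
    define w where "w = ((A, y), z)"
    have F_w: "F w = 0"
      using z(3) q0 by (simp add: w_def)
    have "dist ((A, y0), z0) w \<le> dist y0 y + \<bar>z0 - z\<bar>"
      unfolding w_def dist_Pair_Pair by (simp add: dist_real_def) (rule sqrt_sum_squares_le_sum_abs[THEN order_trans], simp)
    also have "\<dots> < e / 2 + e / 2"
    proof (rule add_less_le_mono)
      show "dist y0 y < e / 2"
        using y(2) by (simp add: r_def dist_commute)
      show "\<bar>z0 - z\<bar> \<le> e / 2"
        using z(1,2) h(4) by linarith
    qed
    finally have "w \<in> good"
      using e(2) by auto
    then have good: "q w \<noteq> 0" "c (A, y) \<noteq> 0"
      by (auto simp: good_def w_def)
    have vanish: "G w = 0" if "real_polynomial_function G" "\<forall>A. \<forall>x\<in>X. G (form_value J j A x) = 0" for G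
      using local[rule_format, OF that(1), of A y z] that(2) F_w good(2) y(1) by (simp add: w_def)
    define x where "x = inverse (q w) *\<^sub>R p w"
    have "x \<in> X"
    proof (rule ccontr)
      assume "x \<notin> X"
      from closedin_zariski_separate[OF X this]
      obtain f where f: "real_polynomial_function f" "\<And>y. y \<in> X \<Longrightarrow> f y = 0" "f x \<noteq> 0"
        by blast
      from real_polynomial_function_homogenize[OF f(1)]
      obtain k g where g: "real_polynomial_function g"
        "\<And>q p. q \<noteq> 0 \<Longrightarrow> g (q, p) = q ^ k * f (inverse q *\<^sub>R p)"
        by metis
      \<comment> \<open>The additional factor \<open>q\<close> is for points with \<open>q = 0\<close>, about which homogenization says
        nothing.\<close>
      have "q v * g (q v, p v) = 0" if v: "v = form_value J j B t" and "t \<in> X" for v B t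
        using pq[OF that(2), of B] f(2)[OF that(2)] by (cases "q v = 0") (auto simp: g(2) v)
      moreover have "real_polynomial_function (\<lambda>v. q v * g (q v, p v))"
        by (intro real_polynomial_function.intros(4) poly real_polynomial_function_comp[OF _ g(1)]
            polynomial_function_Pair polynomial_function_real)
      ultimately have "q w * g (q w, p w) = 0"
        by (intro vanish) auto
      then show False
        using good(1) f(3) by (simp add: g(2) x_def)
    qed
    moreover have "restrict_coords J (A *v x) = y"
      unfolding vec_eq_iff
    proof
      fix k
      show "restrict_coords J (A *v x) $ k = y $ k"
      proof (cases "k \<in> J")
        case False
        then show ?thesis
          using y(1) by (metis restrict_coords_nth)
      next
        case True
        define G where "G v = (fst (fst v) *v p v) $ k - q v * snd (fst v) $ k" for v
        have "real_polynomial_function G"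
          unfolding G_def by (intro polynomial_intros poly)
        moreover have "G (form_value J j B t) = 0" if "t \<in> X" for B t
        proof -
          have "(B *v p (form_value J j B t)) $ k = q (form_value J j B t) * (B *v t) $ k"
            unfolding pq[OF that] by (simp add: matrix_vector_mult_scaleR)
          then show ?thesis
            using True by (simp add: G_def form_value_def)
        qed
        ultimately have "G w = 0"
          by (intro vanish) auto
        then have "(A *v p w) $ k = q w * y $ k"
          by (simp add: G_def w_def)
        then show ?thesis
          using True good(1) by (simp add: x_def matrix_vector_mult_scaleR)
      qed
    qed
    ultimately show ?thesis
      by blast
  qed
  moreover have "r > 0"
    using r0(1) e(1) by (simp add: r_def)
  ultimately show thesis
    by (intro that[of r y0 A]) (auto simp: y0_def)
qed

section \<open>Specialization and transport of relations\<close>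

text \<open>The projection of \<open>X\<close> to the coordinates in \<open>J\<close> is Zariski dense. In contrast to the absence of a
  generic relation this concerns a single matrix, and it passes to some member of a finite closed
  covering.\<close>

definition dominant :: "(real ^ 'n::finite) set \<Rightarrow> 'r::finite set \<Rightarrow> real ^ 'n ^ 'r \<Rightarrow> bool" where
  "dominant X J A \<longleftrightarrow> (\<forall>P. real_polynomial_function P \<longrightarrow> (\<forall>x\<in>X. P (restrict_coords J (A *v x)) = 0) \<longrightarrow>
     (\<forall>y. P (restrict_coords J y) = 0))"

text \<open>A relation \<open>F\<close> may vanish identically in \<open>y\<close> at the given matrix \<open>A0\<close>. Therefore approach \<open>A0\<close>
  along a line of matrices with parameter \<open>t\<close> on which \<open>F\<close> is nontrivial and expand in powers of
  \<open>t\<close>. Dividing by the lowest power that occurs and letting \<open>t\<close> tend to \<open>0\<close> leaves a nonzero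
  polynomial in \<open>y\<close> that vanishes on the projection by \<open>A0\<close>.\<close>

lemma not_generic_relation_of_dominant:
  fixes X :: "(real ^ 'n::finite) set" and J :: "'r::finite set" and A0 :: "real ^ 'n ^ 'r"
  assumes dom: "dominant X J A0"
  shows "\<not> generic_relation X J"
proof
  assume "generic_relation X J"
  then obtain F B y1 where F: "real_polynomial_function (F :: (real ^ 'n ^ 'r) \<times> (real ^ 'r) \<Rightarrow> real)"
    "F (B, restrict_coords J y1) \<noteq> 0"
    "\<And>A x. x \<in> X \<Longrightarrow> F (A, restrict_coords J (A *v x)) = 0"
    unfolding generic_relation_def by blast
  define G where "G w = F (A0 + snd w *\<^sub>R (B - A0), fst w)" for w :: "(real ^ 'r) \<times> real"
  have "real_polynomial_function G"
    unfolding G_def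
    by (rule real_polynomial_function_comp[OF _ F(1)])
      (intro polynomial_intros polynomial_function_mult)
  then obtain N c where c: "\<And>k. real_polynomial_function (c k)"
    "\<And>y t. G (y, t) = (\<Sum>k\<le>N. c k y * t ^ k)"
    using real_polynomial_function_last_variable[of G] by metis
  define nz where "nz k \<longleftrightarrow> k \<le> N \<and> (\<exists>y. c k (restrict_coords J y) \<noteq> 0)" for k
  have "\<exists>k. nz k"
  proof (rule ccontr)
    assume "\<nexists>k. nz k"
    then have "G (restrict_coords J y1, 1) = 0"
      unfolding c(2) by (intro sum.neutral) (auto simp: nz_def)
    then show False
      using F(2) by (simp add: G_def)
  qed
  define m where "m = (LEAST k. nz k)"
  have m: "nz m" "\<And>k. k < m \<Longrightarrow> \<not> nz k"
    unfolding m_def using LeastI_ex[OF \<open>\<exists>k. nz k\<close>] not_less_Least by auto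
  then have "m \<le> N"
    by (simp add: nz_def)
  define g where "g x t = (\<Sum>k\<in>{m..N}. c k (restrict_coords J ((A0 + t *\<^sub>R (B - A0)) *v x)) * t ^ (k - m))"
    for x t
  have g_0: "g x t = 0" if "t \<noteq> 0" "x \<in> X" for x t
  proof -
    let ?y = "restrict_coords J ((A0 + t *\<^sub>R (B - A0)) *v x)"
    have "0 = G (?y, t)"
      unfolding G_def using F(3)[OF that(2)] by simp
    also have "\<dots> = (\<Sum>k\<in>{m..N}. c k ?y * t ^ k)"
      unfolding c(2)
    proof (rule sum.mono_neutral_right)
      show "\<forall>k\<in>{..N} - {m..N}. c k ?y * t ^ k = 0"
      proof
        fix k assume k: "k \<in> {..N} - {m..N}"
        then have "k < m" "k \<le> N"
          by auto
        then show "c k ?y * t ^ k = 0"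
          using m(2)[of k] by (simp add: nz_def)
      qed
    qed auto
    also have "\<dots> = (\<Sum>k\<in>{m..N}. t ^ m * (c k ?y * t ^ (k - m)))"
      by (rule sum.cong) (auto simp: power_add[symmetric])
    also have "\<dots> = t ^ m * g x t"
      by (simp add: g_def sum_distrib_left)
    finally show ?thesis
      using that(1) by simp
  qed
  have "c m (restrict_coords J (A0 *v x)) = 0" if x: "x \<in> X" for x
  proof -
    have "isCont (g x) 0"
    proof -
      have "real_polynomial_function (g x)"
        unfolding g_def
        by (intro real_polynomial_function_sum finite_atLeastAtMost real_polynomial_function.intros(4)
            real_polynomial_function_power real_polynomial_function_comp[OF _ c(1)]
            polynomial_function_restrict_coords polynomial_intros polynomial_function_mult
            real_polynomial_function.intros(1) bounded_linear_ident)
      then show ?thesis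
        by (rule continuous_real_polymonial_function)
    qed
    then have "(g x \<longlongrightarrow> g x 0) (at 0)"
      by (simp add: isCont_def)
    moreover have "(g x \<longlongrightarrow> 0) (at 0)"
      by (rule tendsto_eventually) (use g_0 x in \<open>auto simp: eventually_at_filter\<close>)
    ultimately have "g x 0 = 0"
      using tendsto_unique trivial_limit_at by blast
    moreover have "g x 0 = (\<Sum>k\<in>{m}. c k (restrict_coords J (A0 *v x)) * 0 ^ (k - m))"
      unfolding g_def using \<open>m \<le> N\<close> by (intro sum.mono_neutral_cong_right) auto
    ultimately show ?thesis
      by simp
  qed
  then have "c m (restrict_coords J y) = 0" for y
    using dom c(1) unfolding dominant_def by blast
  then show False
    using m(1) by (simp add: nz_def)
qed

lemma real_polynomial_function_det:
  fixes M :: "'a::real_normed_vector \<Rightarrow> real ^ 'm::finite ^ 'm"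
  assumes "\<And>i j. real_polynomial_function (\<lambda>x. M x $ i $ j)"
  shows "real_polynomial_function (\<lambda>x. det (M x))"
  unfolding det_def
  by (intro real_polynomial_function_sum real_polynomial_function.intros(2,4)
      real_polynomial_function_prod finite_permutations assms) auto

text \<open>With \<open>n\<close> variables and \<open>n + 1\<close> forms, the rows of coefficients bordered by the values of the forms
  make up a square matrix whose last column is a combination of the others; its determinant is the
  relation. Columns are indexed by \<open>'n option\<close>, with \<open>None\<close> for the values.\<close>

lemma generic_relation_UNIV:
  fixes X :: "(real ^ 'n::finite) set"
  assumes "CARD('n) < CARD('r::finite)"
  shows "generic_relation X (UNIV :: 'r set)"
proof -
  have "card (UNIV :: 'n option set) \<le> card (UNIV :: 'r set)"
    using assms by (simp add: card_UNIV_option)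
  then obtain f where f: "inj (f :: 'n option \<Rightarrow> 'r)"
    using card_le_inj[of "UNIV :: 'n option set" "UNIV :: 'r set"] by auto
  define M where "M w = (\<chi> i k. case k of None \<Rightarrow> snd w $ f i | Some l \<Rightarrow> fst w $ f i $ l)"
    for w :: "(real ^ 'n ^ 'r) \<times> (real ^ 'r)"
  have restrict: "restrict_coords UNIV y = y" for y :: "real ^ 'r"
    by (simp add: vec_eq_iff)
  show ?thesis
  proof (rule generic_relationI)
    show "real_polynomial_function (\<lambda>w. det (M w))"
    proof (rule real_polynomial_function_det)
      show "real_polynomial_function (\<lambda>w. M w $ i $ k)" for i k
        by (cases k) (simp_all add: M_def, (intro polynomial_intros)+)
    qed
    define A :: "real ^ 'n ^ 'r" where "A = (\<chi> k l. if k = f (Some l) then 1 else 0)"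
    have "M (A, axis (f None) 1) = mat 1"
      by (auto simp: vec_eq_iff M_def A_def mat_def axis_def inj_eq[OF f] split: option.splits)
    then show "det (M (A, restrict_coords UNIV (axis (f None) 1))) \<noteq> 0"
      by (simp add: restrict)
    show "det (M (A, restrict_coords UNIV (A *v x))) = 0" for A x
    proof -
      define v :: "real ^ 'n option" where "v = (\<chi> k. case k of None \<Rightarrow> - 1 | Some l \<Rightarrow> x $ l)"
      have "M (A, A *v x) *v v = 0"
        unfolding vec_eq_iff
      proof
        fix i
        have "(M (A, A *v x) *v v) $ i = (\<Sum>k\<in>UNIV. M (A, A *v x) $ i $ k * v $ k)"
          by (simp add: matrix_vector_mult_def)
        also have "\<dots> = M (A, A *v x) $ i $ None * v $ None +
            (\<Sum>l\<in>UNIV. M (A, A *v x) $ i $ Some l * v $ Some l)"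
          by (simp add: UNIV_option_conv sum.reindex)
        also have "\<dots> = 0"
          by (simp add: M_def v_def matrix_vector_mult_def)
        finally show "(M (A, A *v x) *v v) $ i = 0 $ i"
          by simp
      qed
      moreover have "v $ None \<noteq> 0"
        by (simp add: v_def)
      then have "v \<noteq> 0"
        by auto
      ultimately show ?thesis
        unfolding restrict by (metis invertible_det_nz matrix_left_invertible_ker invertible_def)
    qed
  qed
qed

text \<open>The rows outside the range of \<open>f\<close> are fixed to those of a matrix at which the relation is nonzero.
  The lemma permits adding rows, so that there are more rows than variables.\<close>

lemma generic_relation_transport:
  fixes X :: "(real ^ 'n::finite) set" and f :: "'s::finite \<Rightarrow> 'r::finite"
  assumes f: "inj f" and rel: "generic_relation X (range f)"
  shows "generic_relation X (UNIV :: 's set)"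
proof -
  obtain F B y1 where F: "real_polynomial_function (F :: (real ^ 'n ^ 'r) \<times> (real ^ 'r) \<Rightarrow> real)"
    "F (B, restrict_coords (range f) y1) \<noteq> 0"
    "\<And>A x. x \<in> X \<Longrightarrow> F (A, restrict_coords (range f) (A *v x)) = 0"
    using rel unfolding generic_relation_def by blast
  define ext :: "real ^ 'n ^ 's \<Rightarrow> real ^ 'n ^ 'r"
    where "ext A = (\<chi> k. if k \<in> range f then A $ (inv f k) else B $ k)" for A
  define ext' :: "real ^ 's \<Rightarrow> real ^ 'r"
    where "ext' y = (\<chi> k. if k \<in> range f then y $ (inv f k) else 0)" for y
  have restrict: "restrict_coords UNIV y = y" for y :: "real ^ 's"
    by (simp add: vec_eq_iff)
  have ext': "ext' (A *v x) = restrict_coords (range f) (ext A *v x)" for A x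
    by (auto simp: vec_eq_iff ext'_def ext_def matrix_vector_mult_def)
  show ?thesis
  proof (rule generic_relationI)
    have "polynomial_function (\<lambda>w. ext (fst w))"
    proof (rule polynomial_function_vec)
      show "polynomial_function (\<lambda>w. ext (fst w) $ k)" for k
        unfolding ext_def by (cases "k \<in> range f") (simp_all, (intro polynomial_intros)+)
    qed
    moreover have "polynomial_function (\<lambda>w. ext' (snd w))"
    proof (rule polynomial_function_vec)
      show "polynomial_function (\<lambda>w. ext' (snd w) $ k)" for k
        unfolding ext'_def by (cases "k \<in> range f") (simp_all, (intro polynomial_intros)+)
    qed
    ultimately show "real_polynomial_function (\<lambda>w. F (ext (fst w), ext' (snd w)))"
      by (intro real_polynomial_function_comp[OF _ F(1)] polynomial_function_Pair)
    have "ext (\<chi> k. B $ f k) = B" "ext' (\<chi> k. y1 $ f k) = restrict_coords (range f) y1"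
      by (auto simp: ext_def ext'_def vec_eq_iff f_inv_into_f)
    then show "F (ext (fst ((\<chi> k. B $ f k), restrict_coords UNIV (\<chi> k. y1 $ f k))),
        ext' (snd ((\<chi> k. B $ f k), restrict_coords UNIV (\<chi> k. y1 $ f k)))) \<noteq> 0"
      using F(2) by (simp add: restrict)
    show "F (ext (fst (A, restrict_coords UNIV (A *v x))), ext' (snd (A, restrict_coords UNIV (A *v x)))) = 0"
      if "x \<in> X" for A x
      using F(3)[OF that] by (simp add: restrict ext')
  qed
qed

section \<open>Chains of irreducible subvarieties\<close>

lemma zariski_minimal_closed:
  fixes V :: "(real ^ 'n::finite) set"
  assumes "closedin zariski V" "P V"
  obtains V' where "V' \<subseteq> V" "closedin zariski V'" "P V'"
    "\<And>W. closedin zariski W \<Longrightarrow> W \<subset> V' \<Longrightarrow> \<not> P W"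
proof -
  define R where "R = {(A, B). closedin zariski A \<and> closedin zariski B \<and> A \<subset> (B :: (real ^ 'n) set)}"
  have "wf R"
    unfolding wf_iff_no_infinite_down_chain
  proof
    assume "\<exists>f. \<forall>i. (f (Suc i), f i) \<in> R"
    then obtain f where f: "\<And>i. (f (Suc i), f i) \<in> R"
      by blast
    then have "closedin zariski (f i)" "f (Suc i) \<subset> f i" for i
      by (auto simp: R_def)
    then show False
      using zariski_noetherian by blast
  qed
  then obtain V' where V': "V' \<in> {W. W \<subseteq> V \<and> closedin zariski W \<and> P W}"
    "\<And>W. (W, V') \<in> R \<Longrightarrow> W \<notin> {W. W \<subseteq> V \<and> closedin zariski W \<and> P W}"
    using assms by (elim wfE_min[of R V "{W. W \<subseteq> V \<and> closedin zariski W \<and> P W}"]) auto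
  have "\<not> P W" if "closedin zariski W" "W \<subset> V'" for W
    using V'(1) V'(2)[of W] that unfolding R_def by blast
  then show ?thesis
    using that[of V'] V'(1) by blast
qed

text \<open>A minimal closed subset with dense projection is irreducible: for two proper closed subsets that
  cover it, equations satisfied by their projections would multiply to an equation satisfied by the
  projection of the whole.\<close>

lemma dominant_irreducible_component:
  assumes "closedin zariski V" "dominant V J A"
  obtains V' where "V' \<subseteq> V" "irreducible_variety V'" "dominant V' J A"
proof (rule zariski_minimal_closed[OF assms(1), of "\<lambda>V. dominant V J A", OF assms(2)])
  fix V'
  assume V': "V' \<subseteq> V" "closedin zariski V'" "dominant V' J A"
    and min: "\<And>W. closedin zariski W \<Longrightarrow> W \<subset> V' \<Longrightarrow> \<not> dominant W J A"
  have "V' \<noteq> {}"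
    using V'(3) real_polynomial_function.intros(2)[of 1] unfolding dominant_def by fastforce
  moreover have False if BC: "closedin zariski B" "closedin zariski C" "B \<subset> V'" "C \<subset> V'" "V' = B \<union> C" for B C
  proof -
    obtain f y where f: "real_polynomial_function f" "\<forall>x\<in>B. f (restrict_coords J (A *v x)) = 0"
      "f (restrict_coords J y) \<noteq> 0"
      using min[OF BC(1,3)] unfolding dominant_def by blast
    obtain g z where g: "real_polynomial_function g" "\<forall>x\<in>C. g (restrict_coords J (A *v x)) = 0"
      "g (restrict_coords J z) \<noteq> 0"
      using min[OF BC(2,4)] unfolding dominant_def by blast
    have "real_polynomial_function (\<lambda>y. f y * g y)"
      by (intro real_polynomial_function.intros(4) f g)
    moreover have "\<forall>x\<in>V'. f (restrict_coords J (A *v x)) * g (restrict_coords J (A *v x)) = 0"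
      using f(2) g(2) BC(5) by auto
    ultimately have "f (restrict_coords J y) * g (restrict_coords J y) = 0" for y
      using V'(3) unfolding dominant_def by blast
    moreover have "real_polynomial_function (\<lambda>y. f (restrict_coords J y))"
      "real_polynomial_function (\<lambda>y. g (restrict_coords J y))"
      by (intro real_polynomial_function_comp[OF _ f(1)] real_polynomial_function_comp[OF _ g(1)]
          polynomial_function_restrict_coords polynomial_function_id)+
    ultimately show False
      using real_polynomial_function_mult_eq_0 f(3) g(3) by blast
  qed
  ultimately have "irreducible_variety V'"
    unfolding irreducible_variety_def using V'(2) by blast
  then show thesis
    using that V' by blast
qed

text \<open>The hyperplane section of \<open>X\<close> through the center of the ball, orthogonal to the coordinate \<open>k\<close>, is
  proper since the ball has points with another \<open>k\<close>-th coordinate. Its projection to \<open>J - {k}\<close>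
  contains a ball and is therefore dense.\<close>

lemma proper_irreducible_subvariety:
  fixes X :: "(real ^ 'n::finite) set" and J :: "'r::finite set"
  assumes X: "closedin zariski X"
    and j: "j \<notin> J" and indep: "\<not> generic_relation X J" and dep: "generic_relation X (insert j J)"
    and k: "k \<in> J"
  obtains X' where "X' \<subset> X" "irreducible_variety X'" "\<not> generic_relation X' (J - {k})"
proof (rule projection_contains_ball[OF X j indep dep])
  fix A :: "real ^ 'n ^ 'r" and y0 r
  assume r: "r > 0" and y0: "restrict_coords J y0 = y0"
    and ball: "\<And>y. restrict_coords J y = y \<Longrightarrow> dist y y0 < r \<Longrightarrow> \<exists>x\<in>X. restrict_coords J (A *v x) = y"
  define V where "V = X \<inter> {x. (A *v x) $ k - y0 $ k = 0}"
  have "closedin zariski {x. (A *v x) $ k - y0 $ k = 0}"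
    unfolding closedin_zariski
  proof (intro exI[of _ "{\<lambda>x. (A *v x) $ k - y0 $ k}"] conjI ballI)
    fix f assume "f \<in> {\<lambda>x. (A *v x) $ k - y0 $ k}"
    moreover have "real_polynomial_function (\<lambda>x. (A *v x) $ k - y0 $ k)"
      by (intro polynomial_intros)
    ultimately show "real_polynomial_function f"
      by simp
  qed simp
  then have V: "closedin zariski V"
    unfolding V_def using X by (intro closedin_Int)
  have "V \<noteq> X"
  proof -
    define y where "y = y0 + (r / 2) *\<^sub>R axis k 1"
    have "restrict_coords J y = restrict_coords J y0 + (r / 2) *\<^sub>R axis k 1"
      using k by (auto simp: y_def vec_eq_iff axis_def)
    then have "restrict_coords J y = y"
      by (simp add: y_def y0)
    moreover have "dist y y0 < r"
      using r by (simp add: y_def dist_norm norm_axis_1)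
    ultimately obtain x where x: "x \<in> X" "restrict_coords J (A *v x) = y"
      using ball by blast
    have "(A *v x) $ k = y $ k"
      using k unfolding x(2)[symmetric] by simp
    then have "x \<notin> V"
      using r by (simp add: V_def y_def)
    then show ?thesis
      using x(1) by blast
  qed
  have "dominant V (J - {k}) A"
    unfolding dominant_def
  proof (intro allI impI)
    fix P y
    assume P: "real_polynomial_function P" "\<forall>x\<in>V. P (restrict_coords (J - {k}) (A *v x)) = 0"
    show "P (restrict_coords (J - {k}) y) = 0"
    proof (rule real_polynomial_function_eq_0_of_open[of "\<lambda>y. P (restrict_coords (J - {k}) y)"])
      show "real_polynomial_function (\<lambda>y. P (restrict_coords (J - {k}) y))"
        by (intro real_polynomial_function_comp[OF _ P(1)] polynomial_function_restrict_coords
            polynomial_function_id)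
      show "open (ball y0 r)" "y0 \<in> ball y0 r"
        using r by auto
      fix y assume y: "y \<in> ball y0 r"
      define y' where "y' = restrict_coords (J - {k}) y + (y0 $ k) *\<^sub>R axis k 1"
      have y': "restrict_coords J y' = y'" "y' $ k = y0 $ k"
        "restrict_coords (J - {k}) y' = restrict_coords (J - {k}) y"
        using k by (auto simp: y'_def vec_eq_iff axis_def)
      have "\<bar>(y' - y0) $ i\<bar> \<le> \<bar>(y - y0) $ i\<bar>" for i
      proof (cases "i \<in> J")
        case True
        then show ?thesis
          by (auto simp: y'_def axis_def)
      next
        case False
        then have "y0 $ i = 0" "y' $ i = 0"
          using y0 y'(1) by (metis restrict_coords_nth)+
        then show ?thesis
          by simp
      qed
      then have "norm (y' - y0) \<le> norm (y - y0)"
        by (intro norm_le_componentwise_cart) simp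
      then have "dist y' y0 < r"
        using y by (simp add: dist_norm norm_minus_commute)
      then obtain x where x: "x \<in> X" "restrict_coords J (A *v x) = y'"
        using ball y'(1) by blast
      have "(A *v x) $ i = y' $ i" if "i \<in> J" for i
        using that unfolding x(2)[symmetric] by simp
      then have "x \<in> V" "restrict_coords (J - {k}) (A *v x) = restrict_coords (J - {k}) y'"
        using x(1) k y'(2) by (auto simp: V_def vec_eq_iff)
      then show "P (restrict_coords (J - {k}) y) = 0"
        using P(2) y'(3) by metis
    qed
  qed
  then obtain X' where X': "X' \<subseteq> V" "irreducible_variety X'" "dominant X' (J - {k}) A"
    using dominant_irreducible_component[OF V] by blast
  have "X' \<subset> X"
    using X'(1) \<open>V \<noteq> X\<close> by (auto simp: V_def)
  then show thesis
    using that X'(2) not_generic_relation_of_dominant[OF X'(3)] by blast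
qed

text \<open>The construction starts from a largest set of rows without a relation, which is at least as large
  as \<open>J\<close>. The hypothesis
  on the number of rows guarantees that a further row is available.\<close>

lemma irreducible_chain:
  fixes X :: "(real ^ 'n::finite) set" and J :: "'r::finite set"
  assumes "CARD('n) < CARD('r)"
    and "irreducible_variety X" "\<not> generic_relation X J" "m \<le> card J"
  shows "\<exists>Z. (\<forall>i\<le>m. irreducible_variety (Z i)) \<and> (\<forall>i<m. Z i \<subset> Z (Suc i)) \<and> Z m = X"
  using assms(2-)
proof (induction m arbitrary: X J)
  case 0
  then show ?case
    by (intro exI[of _ "\<lambda>_. X"]) auto
next
  case (Suc m)
  let ?Q = "\<lambda>K :: 'r set. \<not> generic_relation X K"
  have "\<exists>K. ?Q K \<and> (\<forall>L. ?Q L \<longrightarrow> card L \<le> card K)"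
  proof (rule ex_has_greatest_nat)
    show "?Q J"
      by (rule Suc.prems(2))
    show "\<forall>L. ?Q L \<longrightarrow> card L < Suc CARD('r)"
      by (simp add: card_mono le_imp_less_Suc)
  qed
  then obtain K where K: "?Q K" "\<And>L. ?Q L \<Longrightarrow> card L \<le> card K"
    by blast
  have "K \<noteq> UNIV"
    using K(1) generic_relation_UNIV[OF assms(1)] by blast
  then obtain j where j: "j \<notin> K"
    by blast
  have dep: "generic_relation X (insert j K)"
    using K(2)[of "insert j K"] j by force
  have card: "Suc m \<le> card K"
    using Suc.prems(3) K(2)[OF Suc.prems(2)] by simp
  then obtain k where k: "k \<in> K"
    by fastforce
  have "closedin zariski X"
    using Suc.prems(1) by (simp add: irreducible_variety_def)
  then obtain X' where X': "X' \<subset> X" "irreducible_variety X'" "\<not> generic_relation X' (K - {k})"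
    using proper_irreducible_subvariety[OF _ j K(1) dep k] by blast
  have "m \<le> card (K - {k})"
    using card k by simp
  from Suc.IH[OF X'(2,3) this] obtain Z where Z: "\<forall>i\<le>m. irreducible_variety (Z i)"
    "\<forall>i<m. Z i \<subset> Z (Suc i)" "Z m = X'"
    by blast
  define Z' where "Z' i = (if i \<le> m then Z i else X)" for i
  have "irreducible_variety (Z' i)" for i
    using Z(1) Suc.prems(1) by (simp add: Z'_def)
  moreover have "Z' i \<subset> Z' (Suc i)" if "i < Suc m" for i
  proof (cases "i = m")
    case True
    then show ?thesis
      using Z(3) X'(1) by (simp add: Z'_def)
  next
    case False
    then show ?thesis
      using Z(2) that by (simp add: Z'_def)
  qed
  ultimately show ?case
    by (intro exI[of _ Z']) (simp add: Z'_def)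
qed

text \<open>The rows are padded by as many further ones as there are variables, which leaves room for
  the further row in \<open>irreducible_chain\<close>.\<close>

lemma le_zariski_dim:
  fixes X :: "(real ^ 'n::finite) set"
  assumes irr: "irreducible_variety (zariski closure_of X)"
    and indep: "\<not> generic_relation X (UNIV :: 's::finite set)"
  shows "enat CARD('s) \<le> zariski_dim X"
proof -
  define V where "V = zariski closure_of X"
  have "X \<subseteq> V"
    unfolding V_def by (rule closure_of_subset) simp
  then have "\<not> generic_relation V (UNIV :: 's set)"
    using indep unfolding generic_relation_def by blast
  then have "\<not> generic_relation V (range (Inl :: 's \<Rightarrow> 's + 'n))"
    using generic_relation_transport[of Inl V] by auto
  moreover have "CARD('n) < CARD('s + 'n)"
    by simp
  moreover have "card (range (Inl :: 's \<Rightarrow> 's + 'n)) = CARD('s)"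
    by (simp add: card_image)
  ultimately obtain Z where Z: "\<forall>i\<le>CARD('s). irreducible_variety (Z i)"
    "\<forall>i<CARD('s). Z i \<subset> Z (Suc i)" "Z CARD('s) = V"
    using irreducible_chain[of V "range (Inl :: 's \<Rightarrow> 's + 'n)" "CARD('s)"] irr
    unfolding V_def[symmetric] by auto
  have "Z i \<subseteq> V" if "i \<le> CARD('s)" for i
    using that
  proof (induction rule: inc_induct)
    case base
    then show ?case
      using Z(3) by simp
  next
    case (step i)
    then show ?case
      using Z(2) by blast
  qed
  then show ?thesis
    unfolding zariski_dim_def V_def[symmetric]
    by (intro Sup_upper CollectI exI[of _ "CARD('s)"] exI[of _ Z] conjI refl) (use Z in auto)
qed

section \<open>Genericity, irreducible models and smooth rational maps\<close>

text \<open>Polynomials vanish on the closure of the range iff they vanish after composition with \<open>\<phi>\<close>, and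
  polynomials on the parameter space form an integral domain.\<close>

lemma polynomial_range_irreducible:
  fixes \<phi> :: "'a::euclidean_space \<Rightarrow> 'b::euclidean_space"
  assumes "polynomial_function \<phi>"
  shows "irreducible_variety (zariski closure_of range \<phi>)"
proof -
  let ?V = "zariski closure_of range \<phi>"
  have sub: "range \<phi> \<subseteq> ?V"
    by (rule closure_of_subset) simp
  have sep: "\<exists>f. real_polynomial_function f \<and> (\<forall>x\<in>B. f x = 0) \<and> (\<exists>t. f (\<phi> t) \<noteq> 0)"
    if B: "closedin zariski B" "B \<subset> ?V" for B
  proof -
    have "\<not> range \<phi> \<subseteq> B"
      using closure_of_minimal[OF _ B(1)] B(2) by blast
    then obtain t where "\<phi> t \<notin> B"
      by blast
    then show ?thesis
      using B(1) unfolding closedin_zariski by blast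
  qed
  have False if BC: "closedin zariski B" "closedin zariski C" "B \<subset> ?V" "C \<subset> ?V" "?V = B \<union> C" for B C
  proof -
    obtain f s where f: "real_polynomial_function f" "\<forall>x\<in>B. f x = 0" "f (\<phi> s) \<noteq> 0"
      using sep[OF BC(1,3)] by blast
    obtain g t where g: "real_polynomial_function g" "\<forall>x\<in>C. g x = 0" "g (\<phi> t) \<noteq> 0"
      using sep[OF BC(2,4)] by blast
    have "f (\<phi> u) * g (\<phi> u) = 0" for u
      using sub BC(5) f(2) g(2) by auto
    then show False
      using real_polynomial_function_mult_eq_0[OF real_polynomial_function_comp[OF assms f(1)]
          real_polynomial_function_comp[OF assms g(1)]] f(3) g(3) by blast
  qed
  moreover have "?V \<noteq> {}"
    using sub by blast
  ultimately show ?thesis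
    unfolding irreducible_variety_def using closedin_closure_of[of zariski "range \<phi>"] by blast
qed

lemma valid_model_points:
  fixes M :: "('n::finite, 'l::finite) model"
  assumes "valid_model M"
  shows "irreducible_variety (zariski closure_of points M)" "points M \<noteq> {}"
proof -
  have "irreducible_variety (zariski closure_of points M) \<and> points M \<noteq> {}"
  proof (cases M)
    case (IS fs)
    then have irr: "irreducible_variety (points M)"
      using assms by simp
    then have "zariski closure_of points M = points M"
      by (simp add: irreducible_variety_def closure_of_closedin)
    then show ?thesis
      using irr by (simp add: irreducible_variety_def)
  next
    case (ES \<phi>)
    then have "points M = range \<phi>"
      by auto
    moreover have "polynomial_function \<phi>"
      using assms ES by simp
    ultimately show ?thesis
      by (simp add: polynomial_range_irreducible)
  qed
  then show "irreducible_variety (zariski closure_of points M)" "points M \<noteq> {}"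
    by auto
qed

lemma for_generic_pointI:
  assumes g: "real_polynomial_function g" and x0: "x0 \<in> X" "g x0 \<noteq> 0"
    and P: "\<And>x. x \<in> X \<Longrightarrow> g x \<noteq> 0 \<Longrightarrow> P x"
  shows "for_generic_point X P"
  unfolding for_generic_point_def
proof (intro exI conjI ballI)
  let ?U = "{x. g x \<noteq> 0} \<inter> zariski closure_of X"
  have "openin zariski {x. g x \<noteq> 0}"
    unfolding openin_zariski using g by (intro exI[of _ "{g}"]) auto
  then show "openin (subtopology zariski (zariski closure_of X)) ?U"
    unfolding openin_subtopology by blast
  have "X \<subseteq> zariski closure_of X"
    by (rule closure_of_subset) simp
  then show "?U \<noteq> {}"
    using x0 by blast
  show "P x" if "x \<in> X \<inter> ?U" for x
    using that P by blast
qed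

lemma for_generic_linear_mapI:
  assumes g: "real_polynomial_function g" and "g A0 \<noteq> 0" and "\<And>A. g A \<noteq> 0 \<Longrightarrow> P A"
  shows "for_generic_linear_map P"
  unfolding for_generic_linear_map_def
proof (intro exI conjI ballI)
  show "openin zariski {A. g A \<noteq> 0}"
    unfolding openin_zariski using g by (intro exI[of _ "{g}"]) auto
qed (use assms in auto)

lemma Ck_on_cong:
  assumes "open S" "\<And>x. x \<in> S \<Longrightarrow> f x = g x" "Ck_on k S f"
  shows "Ck_on k S g"
  using assms(2,3)
proof (induction k arbitrary: f g)
  case 0
  then show ?case
    by (simp cong: continuous_on_cong)
next
  case (Suc k)
  have deriv: "(g has_derivative frechet_derivative f (at x)) (at x)" if "x \<in> S" for x
  proof (rule has_derivative_transform_within_open[OF _ assms(1) that])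
    show "(f has_derivative frechet_derivative f (at x)) (at x)"
      using Suc.prems(2) that by (simp add: frechet_derivative_works[symmetric])
  qed (rule Suc.prems(1))
  have "Ck_on k S (\<lambda>x. frechet_derivative g (at x) v)" for v
  proof (rule Suc.IH)
    show "frechet_derivative f (at x) v = frechet_derivative g (at x) v" if "x \<in> S" for x
      using frechet_derivative_at[OF deriv[OF that]] by simp
    show "Ck_on k S (\<lambda>x. frechet_derivative f (at x) v)"
      using Suc.prems(2) by simp
  qed
  then show ?case
    using deriv by (auto simp: differentiable_def)
qed

lemma polynomial_function_has_derivative:
  fixes p :: "'a::euclidean_space \<Rightarrow> 'b::euclidean_space"
  assumes "polynomial_function p"
  shows "\<exists>p'. (\<forall>v. polynomial_function (\<lambda>x. p' x v)) \<and> (\<forall>x. (p has_derivative p' x) (at x))"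
proof -
  have "\<exists>D. (\<forall>v. real_polynomial_function (\<lambda>x. D x v)) \<and>
      (\<forall>x. ((\<lambda>x. p x \<bullet> b) has_derivative D x) (at x))" for b
  proof -
    have "real_polynomial_function (\<lambda>x. p x \<bullet> b)"
      using assms unfolding real_polynomial_function_eq by (rule polynomial_function_inner)
    then show ?thesis
      using real_polynomial_function_has_derivative by metis
  qed
  then obtain D where D: "\<And>b v. real_polynomial_function (\<lambda>x. D b x v)"
    "\<And>b x. ((\<lambda>x. p x \<bullet> b) has_derivative D b x) (at x)"
    by metis
  have "((\<lambda>x. \<Sum>b\<in>Basis. (p x \<bullet> b) *\<^sub>R b) has_derivative (\<lambda>v. \<Sum>b\<in>Basis. D b x v *\<^sub>R b)) (at x)" for x
    by (intro has_derivative_sum has_derivative_scaleR_left D)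
  then have "(p has_derivative (\<lambda>v. \<Sum>b\<in>Basis. D b x v *\<^sub>R b)) (at x)" for x
    by (simp add: euclidean_representation)
  moreover have "polynomial_function (\<lambda>x. \<Sum>b\<in>Basis. D b x v *\<^sub>R b)" for v
    by (intro polynomial_function_sum finite_Basis polynomial_function_mult
        polynomial_function_real D polynomial_function_const)
  ultimately show ?thesis
    by (intro exI[of _ "\<lambda>x v. \<Sum>b\<in>Basis. D b x v *\<^sub>R b"]) blast
qed

text \<open>The powers of the denominator are part of the statement because the quotients \<open>p / q\<^sup>m\<close> are closed
  under directional derivatives.\<close>

lemma rational_function_smooth:
  fixes p :: "'a::euclidean_space \<Rightarrow> 'b::euclidean_space" and q :: "'a \<Rightarrow> real"
  assumes q: "real_polynomial_function q" and p: "polynomial_function p"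
  shows "Ck_on k {y. q y \<noteq> 0} (\<lambda>y. inverse (q y) ^ m *\<^sub>R p y)"
  using p
proof (induction k arbitrary: p m)
  case 0
  show ?case
    unfolding Ck_on.simps
    by (intro continuous_on_scaleR continuous_on_power continuous_on_inverse
        continuous_on_real_polynomial_function[OF q] continuous_on_polymonial_function[OF 0]) auto
next
  case (Suc k)
  obtain q' where q': "\<And>v. real_polynomial_function (\<lambda>x. q' x v)"
    "\<And>x. (q has_derivative q' x) (at x)"
    using real_polynomial_function_has_derivative[OF q] by metis
  obtain p' where p': "\<And>v. polynomial_function (\<lambda>x. p' x v)"
    "\<And>x. (p has_derivative p' x) (at x)"
    using polynomial_function_has_derivative[OF Suc.prems] by metis
  define D where "D y v = inverse (q y) ^ Suc m *\<^sub>R (q y *\<^sub>R p' y v - (real m * q' y v) *\<^sub>R p y)" for y v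
  have deriv: "((\<lambda>y. inverse (q y) ^ m *\<^sub>R p y) has_derivative D y) (at y)" if y: "q y \<noteq> 0" for y
  proof -
    have "((\<lambda>y. inverse (q y)) has_derivative (\<lambda>v. - (inverse (q y) * q' y v * inverse (q y)))) (at y)"
      by (rule Deriv.has_derivative_inverse[OF y q'(2)])
    from has_derivative_scaleR[OF has_derivative_power[OF this, of m] p'(2)]
    have "((\<lambda>y. inverse (q y) ^ m *\<^sub>R p y) has_derivative
       (\<lambda>v. inverse (q y) ^ m *\<^sub>R p' y v +
         (of_nat m * - (inverse (q y) * q' y v * inverse (q y)) * inverse (q y) ^ (m - 1)) *\<^sub>R p y)) (at y)" .
    moreover have "inverse (q y) ^ m *\<^sub>R p' y v +
         (of_nat m * - (inverse (q y) * q' y v * inverse (q y)) * inverse (q y) ^ (m - 1)) *\<^sub>R p y = D y v" for v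
    proof -
      have "inverse (q y) ^ m = inverse (q y) ^ Suc m * q y"
        using y by simp
      moreover have "of_nat m * - (inverse (q y) * q' y v * inverse (q y)) * inverse (q y) ^ (m - 1) =
          - (inverse (q y) ^ Suc m * (real m * q' y v))"
        by (cases m) simp_all
      ultimately show ?thesis
        by (simp only: D_def scaleR_diff_right scaleR_scaleR scaleR_minus_left diff_conv_add_uminus
            scaleR_add_right scaleR_minus_right)
    qed
    ultimately show ?thesis
      by simp
  qed
  have "Ck_on k {y. q y \<noteq> 0} (\<lambda>y. frechet_derivative (\<lambda>y. inverse (q y) ^ m *\<^sub>R p y) (at y) v)" for v
  proof (rule Ck_on_cong[OF open_neq_0_real_polynomial_function[OF q]])
    have "polynomial_function (\<lambda>y. real m * q' y v)"
      by (rule polynomial_function_real)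
        (rule real_polynomial_function.intros(4)[OF real_polynomial_function.intros(2) q'(1)])
    then have "polynomial_function (\<lambda>y. q y *\<^sub>R p' y v - (real m * q' y v) *\<^sub>R p y)"
      using polynomial_function_mult[OF polynomial_function_real[OF q] p'(1)] Suc.prems
      by (intro polynomial_function_diff) (simp_all add: polynomial_function_mult)
    then show "Ck_on k {y. q y \<noteq> 0} (\<lambda>y. D y v)"
      unfolding D_def by (rule Suc.IH)
    show "D y v = frechet_derivative (\<lambda>y. inverse (q y) ^ m *\<^sub>R p y) (at y) v"
      if "y \<in> {y. q y \<noteq> 0}" for y
      using frechet_derivative_at[OF deriv] that by simp
  qed
  then show ?case
    unfolding Ck_on.simps using differentiableI[OF deriv] by simp
qed

section \<open>Generic fibers\<close>

lemma generic_rational_inverse: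
  fixes X :: "(real ^ 'n::finite) set"
  assumes "generic_relation X (UNIV :: 's::finite set)" "X \<noteq> {}"
  obtains q :: "(real ^ 'n ^ 's) \<times> (real ^ 's) \<Rightarrow> real" and p A0 x0
  where "real_polynomial_function q" "polynomial_function p"
    "\<And>A x. x \<in> X \<Longrightarrow> p (A, A *v x) = q (A, A *v x) *\<^sub>R x" "x0 \<in> X" "q (A0, A0 *v x0) \<noteq> 0"
proof -
  obtain J :: "'s set" and j where J: "j \<notin> J" "\<not> generic_relation X J" "generic_relation X (insert j J)"
    by (rule generic_relation_critical[OF assms])
  define w where "w v = ((fst v, restrict_coords J (snd v)), snd v $ j)"
    for v :: "(real ^ 'n ^ 's) \<times> (real ^ 's)"
  have w: "w (A, A *v x) = form_value J j A x" for A x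
    by (simp add: w_def form_value_def)
  have poly_w: "polynomial_function w"
    unfolding w_def
    by (intro polynomial_intros polynomial_function_restrict_coords)
  show thesis
  proof (rule birational_hypersurface[OF J])
    fix F q p c A0 x0
    assume q: "real_polynomial_function q" and p: "polynomial_function p"
      and pq: "\<And>A x. x \<in> X \<Longrightarrow> p (form_value J j A x) = q (form_value J j A x) *\<^sub>R x"
      and x0: "x0 \<in> X" "q (form_value J j A0 x0) \<noteq> 0"
    show thesis
    proof (rule that)
      show "real_polynomial_function (\<lambda>v. q (w v))"
        by (rule real_polynomial_function_comp[OF poly_w q])
      show "polynomial_function (\<lambda>v. p (w v))"
        using polynomial_function_compose[OF poly_w p] unfolding o_def .
      show "p (w (A, A *v x)) = q (w (A, A *v x)) *\<^sub>R x" if "x \<in> X" for A x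
        unfolding w by (rule pq[OF that])
      show "x0 \<in> X" "q (w (A0, A0 *v x0)) \<noteq> 0"
        unfolding w by (fact x0)+
    qed
  qed
qed

text \<open>If \<open>q\<close> does not vanish at \<open>(A, A *v x)\<close>, then neither does it at any point with the same image, so
  the rational inverse recovers all points of the fiber, and they agree.\<close>

lemma generic_injectivity:
  fixes X :: "(real ^ 'n::finite) set"
  assumes "generic_relation X (UNIV :: 's::finite set)" "X \<noteq> {}"
  shows "for_generic_linear_map (\<lambda>A :: real ^ 'n ^ 's.
    for_generic_point X (\<lambda>x. fiber X A (A *v x) = {x}) \<and>
    for_generic_point X (\<lambda>x. fiber_smooth_at X A (A *v x)))"
proof (rule generic_rational_inverse[OF assms])
  fix q :: "(real ^ 'n ^ 's) \<times> (real ^ 's) \<Rightarrow> real" and p A0 x0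
  assume q: "real_polynomial_function q" and p: "polynomial_function p"
    and pq: "\<And>A x. x \<in> X \<Longrightarrow> p (A, A *v x) = q (A, A *v x) *\<^sub>R x"
    and x0: "x0 \<in> X" "q (A0, A0 *v x0) \<noteq> 0"
  show ?thesis
  proof (rule for_generic_linear_mapI[of "\<lambda>A. q (A, A *v x0)" A0])
    show "real_polynomial_function (\<lambda>A. q (A, A *v x0))"
      by (intro real_polynomial_function_comp[OF _ q] polynomial_intros)
    show "q (A0, A0 *v x0) \<noteq> 0"
      by (rule x0(2))
    fix A
    assume A: "q (A, A *v x0) \<noteq> 0"
    define h where "h y = inverse (q (A, y)) ^ 1 *\<^sub>R p (A, y)" for y
    have h: "h (A *v x) = x" if "x \<in> X" "q (A, A *v x) \<noteq> 0" for x
      using that by (simp add: h_def pq)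
    have fiber: "fiber X A (A *v x) = {x}" if "x \<in> X" "q (A, A *v x) \<noteq> 0" for x
    proof -
      have "x' = x" if "x' \<in> X" "A *v x' = A *v x" for x'
        using h[of x] h[of x'] that \<open>x \<in> X\<close> \<open>q (A, A *v x) \<noteq> 0\<close> by simp
      then show ?thesis
        using that by (auto simp: fiber_def)
    qed
    have poly: "real_polynomial_function (\<lambda>x. q (A, A *v x))"
      by (intro real_polynomial_function_comp[OF _ q] polynomial_intros)
    have poly_q: "real_polynomial_function (\<lambda>y. q (A, y))"
      by (intro real_polynomial_function_comp[OF _ q] polynomial_intros)
    have poly_p: "polynomial_function (\<lambda>y. p (A, y))"
      using polynomial_function_compose[OF _ p, of "\<lambda>y. (A, y)"] polynomial_intros
      by (simp add: o_def polynomial_function_Pair)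
    have "fiber_smooth_at X A (A *v x)" if x: "x \<in> X" "q (A, A *v x) \<noteq> 0" for x
      unfolding fiber_smooth_at_def
    proof (intro exI conjI ballI)
      let ?V = "{y. q (A, y) \<noteq> 0}"
      let ?U = "(*v) A ` X \<inter> ?V"
      have "open ?V"
        by (rule open_neq_0_real_polynomial_function[OF poly_q])
      then show "openin (top_of_set ((*v) A ` X)) ?U"
        by (rule openin_open_Int)
      show "A *v x \<in> ?U"
        using x by blast
      show "fiber X A y = {h y}" if y: "y \<in> ?U" for y
      proof -
        obtain x' where "x' \<in> X" "y = A *v x'" "q (A, A *v x') \<noteq> 0"
          using y by blast
        then show ?thesis
          using fiber[of x'] h[of x'] by simp
      qed
      show "smooth_on_subset ?U h"
        unfolding smooth_on_subset_def
      proof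
        fix y assume "y \<in> ?U"
        moreover have "Ck_on k ?V h" for k
          unfolding h_def by (rule rational_function_smooth[OF poly_q poly_p])
        ultimately show "\<exists>V g. open V \<and> y \<in> V \<and> (\<forall>k. Ck_on k V g) \<and> (\<forall>z\<in>?U \<inter> V. h z = g z)"
          using \<open>open ?V\<close> by (intro exI[of _ ?V] exI[of _ h]) auto
      qed
    qed
    then show "for_generic_point X (\<lambda>x. fiber X A (A *v x) = {x}) \<and>
        for_generic_point X (\<lambda>x. fiber_smooth_at X A (A *v x))"
      by (intro conjI for_generic_pointI[where g = "\<lambda>x. q (A, A *v x)", OF poly x0(1) A] fiber)
  qed
qed

lemma finite_vec:
  fixes T :: "'n::finite \<Rightarrow> 'a set"
  assumes "\<And>i. finite (T i)"
  shows "finite {x :: 'a ^ 'n. \<forall>i. x $ i \<in> T i}"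
proof (rule finite_subset)
  show "{x :: 'a ^ 'n. \<forall>i. x $ i \<in> T i} \<subseteq> vec_lambda ` (PiE UNIV T)"
  proof
    fix x :: "'a ^ 'n" assume "x \<in> {x. \<forall>i. x $ i \<in> T i}"
    then have "($) x \<in> PiE UNIV T" "x = vec_lambda (($) x)"
      by (auto simp: vec_eq_iff)
    then show "x \<in> vec_lambda ` (PiE UNIV T)"
      using image_eqI[of x vec_lambda "($) x"] by blast
  qed
  show "finite (vec_lambda ` (PiE UNIV T))"
    using assms by (intro finite_imageI finite_PiE) auto
qed

text \<open>The relation on \<open>'s option\<close> is read as a polynomial in the value of the additional form \<open>b\<close>, the row
  \<open>None\<close>. One of its coefficients is nonzero at a point of the graph, and this remains true for
  all \<open>b\<close> in a ball. On the fiber through a generic \<open>x\<close> the values of such a form are roots of a fixed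
  nonzero polynomial. The coordinate \<open>x $ i\<close> is a multiple of the difference of the two forms \<open>d i\<close>
  and \<open>b\<close>, so it takes finitely many values.\<close>

lemma generic_finiteness:
  fixes X :: "(real ^ 'n::finite) set"
  assumes indep: "\<not> generic_relation X (UNIV :: 's::finite set)"
    and dep: "generic_relation X (UNIV :: 's option set)"
  shows "for_generic_linear_map (\<lambda>A :: real ^ 'n ^ 's.
    for_generic_point X (\<lambda>x. finite (fiber X A (A *v x))))"
proof -
  have restrict: "restrict_coords UNIV y = y" for y :: "real ^ 'k::finite"
    by (simp add: vec_eq_iff)
  obtain F B y1 where F: "real_polynomial_function (F :: (real ^ 'n ^ 's option) \<times> (real ^ 's option) \<Rightarrow> real)"
    "F (B, y1) \<noteq> 0" "\<And>A x. x \<in> X \<Longrightarrow> F (A, A *v x) = 0"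
    using dep unfolding generic_relation_def restrict by blast
  define row :: "real ^ 'n ^ 's \<Rightarrow> real ^ 'n \<Rightarrow> real ^ 'n ^ 's option"
    where "row A b = (\<chi> k. case k of None \<Rightarrow> b | Some l \<Rightarrow> A $ l)" for A b
  define entry :: "real ^ 's \<Rightarrow> real \<Rightarrow> real ^ 's option"
    where "entry y z = (\<chi> k. case k of None \<Rightarrow> z | Some l \<Rightarrow> y $ l)" for y z
  have row_mult: "row A b *v x = entry (A *v x) (b \<bullet> x)" for A b x
    unfolding vec_eq_iff
    by (auto simp: row_def entry_def matrix_vector_mul_component split: option.splits)
  define G where "G w = F (row (fst (fst w)) (fst (snd (fst w))), entry (snd (snd (fst w))) (snd w))"
    for w :: "((real ^ 'n ^ 's) \<times> (real ^ 'n) \<times> (real ^ 's)) \<times> real"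
  have "polynomial_function (\<lambda>w :: ((real ^ 'n ^ 's) \<times> (real ^ 'n) \<times> (real ^ 's)) \<times> real.
      row (fst (fst w)) (fst (snd (fst w))))"
  proof (rule polynomial_function_vec)
    show "polynomial_function (\<lambda>w :: ((real ^ 'n ^ 's) \<times> (real ^ 'n) \<times> (real ^ 's)) \<times> real.
        row (fst (fst w)) (fst (snd (fst w))) $ k)" for k
      unfolding row_def by (cases k) (simp_all, (intro polynomial_intros)+)
  qed
  moreover have "polynomial_function (\<lambda>w :: ((real ^ 'n ^ 's) \<times> (real ^ 'n) \<times> (real ^ 's)) \<times> real.
      entry (snd (snd (fst w))) (snd w))"
  proof (rule polynomial_function_vec)
    show "polynomial_function (\<lambda>w :: ((real ^ 'n ^ 's) \<times> (real ^ 'n) \<times> (real ^ 's)) \<times> real.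
        entry (snd (snd (fst w))) (snd w) $ k)" for k
      unfolding entry_def by (cases k) (simp_all, (intro polynomial_intros)+)
  qed
  ultimately have "real_polynomial_function G"
    unfolding G_def by (intro real_polynomial_function_comp[OF _ F(1)] polynomial_function_Pair)
  then obtain N c where c: "\<And>k. real_polynomial_function (c k)"
    "\<And>u z. G (u, z) = (\<Sum>k\<le>N. c k u * z ^ k)"
    using real_polynomial_function_last_variable[of G] by metis
  define A1 where "A1 = (\<chi> l. B $ Some l)"
  define b where "b = B $ None"
  have "row A1 b = B" "entry (\<chi> l. y1 $ Some l) (y1 $ None) = y1"
    by (auto simp: vec_eq_iff row_def entry_def A1_def b_def split: option.splits)
  then have "G ((A1, b, \<chi> l. y1 $ Some l), y1 $ None) \<noteq> 0"
    using F(2) by (simp add: G_def)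
  then obtain m where m: "m \<le> N" "c m (A1, b, \<chi> l. y1 $ Some l) \<noteq> 0"
  proof -
    assume "G ((A1, b, \<chi> l. y1 $ Some l), y1 $ None) \<noteq> 0"
    then obtain m where "m \<in> {..N}" "c m (A1, b, \<chi> l. y1 $ Some l) * (y1 $ None) ^ m \<noteq> 0"
      unfolding c(2) by (rule sum.not_neutral_contains_not_neutral)
    then show thesis
      by (intro that[of m]) auto
  qed
  have "real_polynomial_function (\<lambda>v :: (real ^ 'n ^ 's) \<times> (real ^ 's). c m (fst v, b, snd v))"
    by (intro real_polynomial_function_comp[OF _ c(1)] polynomial_intros)
  from not_generic_relationD[OF indep this, of A1 "\<chi> l. y1 $ Some l"]
  obtain A0 x0 where A0: "x0 \<in> X" "c m (A0, b, A0 *v x0) \<noteq> 0"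
    using m(2) unfolding restrict by auto
  have "open {d. c m (A0, d, A0 *v x0) \<noteq> 0}"
    by (intro open_neq_0_real_polynomial_function real_polynomial_function_comp[OF _ c(1)]
        polynomial_intros)
  then obtain e where e: "e > 0" "ball b e \<subseteq> {d. c m (A0, d, A0 *v x0) \<noteq> 0}"
    using A0(2) by (auto elim!: openE)
  define d where "d i = b + (e / 2) *\<^sub>R axis i 1" for i
  have "d i \<in> ball b e" for i
    using e(1) by (simp add: d_def dist_norm norm_axis_1)
  then have d: "c m (A0, d i, A0 *v x0) \<noteq> 0" for i
    using e(2) by blast
  define g where "g A x = c m (A, b, A *v x) * (\<Prod>i\<in>UNIV. c m (A, d i, A *v x))" for A x
  have poly_g: "real_polynomial_function (\<lambda>t. g (P t) (Q t))"
    if "polynomial_function P" "polynomial_function Q" for P :: "'t::euclidean_space \<Rightarrow> real ^ 'n ^ 's" and Q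
    unfolding g_def
    by (intro real_polynomial_function.intros(4) real_polynomial_function_prod finite
        real_polynomial_function_comp[OF _ c(1)] polynomial_intros that)
  show ?thesis
  proof (rule for_generic_linear_mapI[of "\<lambda>A. g A x0" A0])
    show "real_polynomial_function (\<lambda>A. g A x0)"
      by (intro poly_g polynomial_intros)
    show "g A0 x0 \<noteq> 0"
      using A0(2) d by (simp add: g_def)
    fix A
    assume A: "g A x0 \<noteq> 0"
    show "for_generic_point X (\<lambda>x. finite (fiber X A (A *v x)))"
    proof (rule for_generic_pointI[of "\<lambda>x. g A x" x0])
      show "real_polynomial_function (\<lambda>x. g A x)"
        by (intro poly_g polynomial_intros)
      show "x0 \<in> X" "g A x0 \<noteq> 0"
        by (fact A0 A)+
      fix x
      assume x: "x \<in> X" "g A x \<noteq> 0"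
      define R where "R a = {z. (\<Sum>k\<le>N. c k (A, a, A *v x) * z ^ k) = 0}" for a
      have fin: "finite (R a)" if "c m (A, a, A *v x) \<noteq> 0" for a
        unfolding R_def polyfun_finite_roots using m(1) that by blast
      have "finite (R b)" "finite (R (d i))" for i
        using x(2) by (auto simp: g_def intro!: fin)
      define T where "T i = (\<lambda>(s, t). (s - t) / (e / 2)) ` (R (d i) \<times> R b)" for i
      have "finite {x' :: real ^ 'n. \<forall>i. x' $ i \<in> T i}"
        unfolding T_def using \<open>finite (R b)\<close> \<open>\<And>i. finite (R (d i))\<close> by (intro finite_vec) auto
      moreover have "fiber X A (A *v x) \<subseteq> {x'. \<forall>i. x' $ i \<in> T i}"
      proof (intro subsetI CollectI allI)
        fix x' i
        assume x': "x' \<in> fiber X A (A *v x)"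
        have root: "a \<bullet> x' \<in> R a" for a
        proof -
          have "F (row A a, entry (A *v x') (a \<bullet> x')) = 0"
            using F(3)[of x' "row A a"] x' by (simp add: fiber_def row_mult)
          then have "G ((A, a, A *v x), a \<bullet> x') = 0"
            using x' by (simp add: G_def fiber_def)
          then show ?thesis
            by (simp add: R_def c(2))
        qed
        have "x' $ i = (d i \<bullet> x' - b \<bullet> x') / (e / 2)"
          using e(1) by (simp add: d_def inner_add_left inner_axis')
        moreover have "(d i \<bullet> x', b \<bullet> x') \<in> R (d i) \<times> R b"
          using root by blast
        ultimately show "x' $ i \<in> T i"
          unfolding T_def by (intro image_eqI[of _ _ "(d i \<bullet> x', b \<bullet> x')"]) simp_all
      qed
      ultimately show "finite (fiber X A (A *v x))"
        by (rule rev_finite_subset)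
    qed
  qed
qed

lemma fiber_nonempty_iff_system_solvable:
  "fiber (points M) A y \<noteq> {} \<longleftrightarrow> system_solvable M A y"
  by (cases M) (auto simp: fiber_def)

lemma for_generic_linear_map_mono:
  "for_generic_linear_map P \<Longrightarrow> (\<And>A. P A \<Longrightarrow> Q A) \<Longrightarrow> for_generic_linear_map Q"
  unfolding for_generic_linear_map_def by blast

lemma for_generic_point_mono:
  "for_generic_point X P \<Longrightarrow> (\<And>x. x \<in> X \<Longrightarrow> P x \<Longrightarrow> Q x) \<Longrightarrow> for_generic_point X Q"
  unfolding for_generic_point_def by blast

theorem theorem1p1:
  fixes M :: "('n::finite, 'l::finite) model"
    and X :: "(real^'n) set"
    and d :: enat
  assumes "valid_model M"
    and "X = points M"
    and "d = zariski_dim X"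
  shows "for_generic_linear_map (\<lambda>A :: real^'n^'s::finite.
     (\<forall>y. fiber X A y \<noteq> {} \<longleftrightarrow> system_solvable M A y) \<and>
     (enat CARD('s) \<ge> d \<longrightarrow>
        for_generic_point X (\<lambda>x. finite (fiber X A (A *v x)))) \<and>
     (enat CARD('s) \<ge> d + 1 \<longrightarrow>
        for_generic_point X (\<lambda>x. fiber X A (A *v x) = {x})) \<and>
     (enat CARD('s) \<ge> d + 1 \<longrightarrow>
        for_generic_point X (\<lambda>x. fiber_smooth_at X A (A *v x))))"
proof -
  have irr: "irreducible_variety (zariski closure_of X)" and ne: "X \<noteq> {}"
    using valid_model_points[OF assms(1)] assms(2) by auto
  have solvable: "fiber X A y \<noteq> {} \<longleftrightarrow> system_solvable M A y" for A :: "real^'n^'s" and y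
    unfolding assms(2) by (rule fiber_nonempty_iff_system_solvable)
  \<comment> \<open>If generic forms on these rows have a relation, all assertions hold. If not, then \<open>d\<close> is at least the number
    of rows, so that injectivity and smoothness claim nothing and finiteness concerns the case of
    equality only.\<close>
  show ?thesis
  proof (cases "generic_relation X (UNIV :: 's set)")
    case True
    show ?thesis
    proof (rule for_generic_linear_map_mono[OF generic_injectivity[OF True ne]])
      fix A :: "real^'n^'s"
      assume A: "for_generic_point X (\<lambda>x. fiber X A (A *v x) = {x}) \<and>
        for_generic_point X (\<lambda>x. fiber_smooth_at X A (A *v x))"
      then have "for_generic_point X (\<lambda>x. finite (fiber X A (A *v x)))"
        by (elim conjE for_generic_point_mono) simp
      then show "(\<forall>y. fiber X A y \<noteq> {} \<longleftrightarrow> system_solvable M A y) \<and>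
        (enat CARD('s) \<ge> d \<longrightarrow> for_generic_point X (\<lambda>x. finite (fiber X A (A *v x)))) \<and>
        (enat CARD('s) \<ge> d + 1 \<longrightarrow> for_generic_point X (\<lambda>x. fiber X A (A *v x) = {x})) \<and>
        (enat CARD('s) \<ge> d + 1 \<longrightarrow> for_generic_point X (\<lambda>x. fiber_smooth_at X A (A *v x)))"
        using A solvable by blast
    qed
  next
    case False
    have "enat CARD('s) \<le> d"
      unfolding assms(3) by (rule le_zariski_dim[OF irr False])
    then have not_gt: "\<not> d + 1 \<le> enat CARD('s)"
      by (cases d) (auto simp: one_enat_def)
    show ?thesis
    proof (cases "d \<le> enat CARD('s)")
      case True
      have "generic_relation X (UNIV :: 's option set)"
      proof (rule ccontr)
        assume "\<not> generic_relation X (UNIV :: 's option set)"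
        from le_zariski_dim[OF irr this] have "enat CARD('s option) \<le> d"
          unfolding assms(3) .
        then show False
          using True by (cases d) (auto simp: card_UNIV_option)
      qed
      from generic_finiteness[OF False this] show ?thesis
        by (rule for_generic_linear_map_mono) (use solvable not_gt in auto)
    next
      case False
      show ?thesis
        by (rule for_generic_linear_mapI[of "\<lambda>_. 1" 0])
          (use False not_gt solvable in \<open>auto simp: real_polynomial_function.intros(2)\<close>)
    qed
  qed
qed

end
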